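(* Let $\Omega\subset\mathbb{R}^2$ be a domain with $\partial\Omega\neq\emptyset$ on which Hardy's inequality holds, i.e. there is a constant $H$ such that $\left\|\frac{u}{\delta}\right\|_{L^2(\Omega)}\leq H\|\nabla u\|_{L^2(\Omega)}$ for all $u\in H^1_0(\Omega)$. Then, for any $u\in H^1_0(\Omega)$, \[ \frac{\exp(u^2)-1}{\delta^2}\in L^1(\Omega). \]
   Context: A domain is a connected open set. $\delta(x)$ denotes the distance from $x\in\Omega$ to $\partial\Omega$. Functions are real-valued and integrals are with respect to Lebesgue measure. *)

theory Defs
  imports "HOL-Analysis.Analysis"
begin

definition partial_deriv :: "'n::finite \<Rightarrow> (real ^ 'n \<Rightarrow> real) \<Rightarrow> real ^ 'n \<Rightarrow> real" where
  "partial_deriv i f x = frechet_derivative f (at x) (axis i 1)"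

definition gradient :: "(real ^ 'n::finite \<Rightarrow> real) \<Rightarrow> real ^ 'n \<Rightarrow> real ^ 'n" where
  "gradient f x = (\<chi> i. partial_deriv i f x)"

primrec C_k :: "nat \<Rightarrow> (real ^ 'n::finite \<Rightarrow> real) \<Rightarrow> bool" where
  "C_k 0 f \<longleftrightarrow> continuous_on UNIV f"
| "C_k (Suc k) f \<longleftrightarrow> (\<forall>x. f differentiable (at x)) \<and> (\<forall>i. C_k k (partial_deriv i f))"

text \<open>Elements of \<open>C\<^sub>c\<^sup>\<infinity>(\<Omega>)\<close> are taken to be extended by zero to the whole space.\<close>

definition test_function :: "(real ^ 'n::finite) set \<Rightarrow> (real ^ 'n \<Rightarrow> real) \<Rightarrow> bool" where
  "test_function \<Omega> \<phi> \<longleftrightarrow>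
     (\<forall>k. C_k k \<phi>) \<and> compact (closure {x. \<phi> x \<noteq> 0}) \<and> closure {x. \<phi> x \<noteq> 0} \<subseteq> \<Omega>"

text \<open>
  A function on \<open>\<Omega>\<close> is represented by a total function whose values outside \<open>\<Omega>\<close> are irrelevant.
  Functions that agree almost everywhere in \<open>\<Omega>\<close> are not identified; all notions below are
  invariant under such changes.
\<close>

definition in_L2 :: "(real ^ 'n::finite) set \<Rightarrow> (real ^ 'n \<Rightarrow> 'b::euclidean_space) \<Rightarrow> bool" where
  "in_L2 \<Omega> f \<longleftrightarrow>
     f \<in> borel_measurable (lebesgue_on \<Omega>) \<and> integrable (lebesgue_on \<Omega>) (\<lambda>x. (norm (f x))\<^sup>2)"

text \<open>The following is the norm only for members of \<open>L\<^sup>2(\<Omega>)\<close>; the Bochner integral of a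
  function that is not integrable is 0.\<close>

definition L2_norm :: "(real ^ 'n::finite) set \<Rightarrow> (real ^ 'n \<Rightarrow> 'b::euclidean_space) \<Rightarrow> real" where
  "L2_norm \<Omega> f = sqrt (integral\<^sup>L (lebesgue_on \<Omega>) (\<lambda>x. (norm (f x))\<^sup>2))"

definition locally_integrable ::
    "(real ^ 'n::finite) set \<Rightarrow> (real ^ 'n \<Rightarrow> 'b::euclidean_space) \<Rightarrow> bool" where
  "locally_integrable \<Omega> f \<longleftrightarrow> (\<forall>K. compact K \<and> K \<subseteq> \<Omega> \<longrightarrow> f absolutely_integrable_on K)"

definition weak_gradient ::
    "(real ^ 'n::finite) set \<Rightarrow> (real ^ 'n \<Rightarrow> real) \<Rightarrow> (real ^ 'n \<Rightarrow> real ^ 'n) \<Rightarrow> bool" where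
  "weak_gradient \<Omega> u g \<longleftrightarrow>
     locally_integrable \<Omega> u \<and> locally_integrable \<Omega> g \<and>
     (\<forall>\<phi> i. test_function \<Omega> \<phi> \<longrightarrow>
        integral\<^sup>L (lebesgue_on \<Omega>) (\<lambda>x. u x * partial_deriv i \<phi> x) =
        - integral\<^sup>L (lebesgue_on \<Omega>) (\<lambda>x. g x $ i * \<phi> x))"

text \<open>\<open>H\<^sup>1\<^sub>0(\<Omega>)\<close> is the closure of \<open>C\<^sub>c\<^sup>\<infinity>(\<Omega>)\<close> in \<open>H\<^sup>1(\<Omega>)\<close>.\<close>

definition H1_0 :: "(real ^ 'n::finite) set \<Rightarrow> (real ^ 'n \<Rightarrow> real) set" where
  "H1_0 \<Omega> = {u. in_L2 \<Omega> u \<and> (\<exists>g. weak_gradient \<Omega> u g \<and> in_L2 \<Omega> g \<and>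
     (\<exists>\<phi>. (\<forall>n::nat. test_function \<Omega> (\<phi> n)) \<and>
        (\<lambda>n. L2_norm \<Omega> (\<lambda>x. \<phi> n x - u x)) \<longlonglongrightarrow> 0 \<and>
        (\<lambda>n. L2_norm \<Omega> (\<lambda>x. gradient (\<phi> n) x - g x)) \<longlonglongrightarrow> 0))}"

definition boundary_dist :: "(real ^ 'n::finite) set \<Rightarrow> real ^ 'n \<Rightarrow> real" where
  "boundary_dist \<Omega> x = infdist x (frontier \<Omega>)"

text \<open>The right-hand side of Hardy's inequality is always finite, so the inequality includes the
  assertion that \<open>u / \<delta>\<close> belongs to \<open>L\<^sup>2(\<Omega>)\<close>. The weak gradient \<open>g\<close> is unique almost everywhere.\<close>

definition hardy_inequality :: "(real ^ 'n::finite) set \<Rightarrow> real \<Rightarrow> bool" where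
  "hardy_inequality \<Omega> H \<longleftrightarrow>
     (\<forall>u g. u \<in> H1_0 \<Omega> \<and> weak_gradient \<Omega> u g \<longrightarrow>
        in_L2 \<Omega> (\<lambda>x. u x / boundary_dist \<Omega> x) \<and>
        L2_norm \<Omega> (\<lambda>x. u x / boundary_dist \<Omega> x) \<le> H * L2_norm \<Omega> g)"

end

theory Submission
  imports Defs
begin

text \<open>
  Write \<open>\<delta>\<close> for the distance to the boundary. The heart of the matter is a bound for test functions
  \<open>v\<close> with small gradient: then \<open>(exp (2 v\<^sup>2) - 1) / \<delta>\<^sup>2\<close> has integral at most 5. It is a weighted
  Trudinger inequality, proved without decomposing \<open>\<Omega>\<close> into cubes of size comparable to \<open>\<delta>\<close>: each
  point \<open>x\<close> uses its own ball, of radius \<open>\<delta> x / 2\<close>.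

  Averaging the fundamental theorem of calculus over this ball bounds \<open>\<pi> |v x|\<close> by the integral of
  \<open>G y / |x - y|\<close> over it, where \<open>G = |\<nabla>v| + 3 |v| / \<delta>\<close> (\<open>abs_le_truncated_potential\<close>). By Hardy's
  inequality the square integral of \<open>G\<close> is at most a constant times that of \<open>\<nabla>v\<close>
  (\<open>test_function_hardy_energy_le\<close>); this is the only place where the hypothesis on \<open>\<Omega>\<close> enters.
  To estimate the power \<open>2 k\<close> of the potential, split the kernel \<open>1 / |x - y|\<close> by the Cauchy-Schwarz
  inequality into \<open>|x - y| powr (1/k - 2)\<close>, whose integral over the ball grows only linearly in \<open>k\<close>,
  and \<open>G\<^sup>2 |x - y| powr (-1/k)\<close>, to which Jensen's inequality for the \<open>k\<close>-th power and the measure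
  \<open>G\<^sup>2 dy\<close> applies (\<open>truncated_potential_power_le\<close>). Tonelli's theorem then shows that the integral
  of \<open>v\<^sup>2\<^sup>k / \<delta>\<^sup>2\<close> is at most \<open>5 k\<^sup>k\<close> times the \<open>k\<close>-th power of the integral of \<open>G\<^sup>2\<close>
  (\<open>weighted_even_power_integral_le\<close>). Since \<open>k\<^sup>k \<le> 3\<^sup>k k!\<close>, summing the exponential series gives the
  bound when \<open>G\<close> is small in \<open>L\<^sup>2\<close>.

  For \<open>u\<close> in \<open>H\<^sup>1\<^sub>0(\<Omega>)\<close> with approximating test functions \<open>\<phi>\<^sub>n\<close>, fix one of them, \<open>\<psi>\<close>, with
  \<open>\<nabla>\<phi>\<^sub>n - \<nabla>\<psi>\<close> small for all later \<open>n\<close>. Fatou's lemma transfers the bound from \<open>\<phi>\<^sub>n - \<psi>\<close> to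
  \<open>u - \<psi>\<close>. As \<open>\<psi>\<close> is bounded with compact support in \<open>\<Omega>\<close>, the elementary inequality
  \<open>u\<^sup>2 \<le> 2 (u - \<psi>)\<^sup>2 + 2 \<psi>\<^sup>2\<close> finishes the proof.
\<close>

section \<open>Smooth functions with compact support\<close>

lemma C_k_1_differentiable: "C_k 1 f \<Longrightarrow> f differentiable (at x)"
  by simp

lemma C_k_1_continuous_on: "C_k 1 f \<Longrightarrow> continuous_on S f"
  by (meson C_k_1_differentiable continuous_at_imp_continuous_on differentiable_imp_continuous_within)

lemma C_k_1_continuous_on_gradient: "C_k 1 f \<Longrightarrow> continuous_on S (gradient f)"
  unfolding gradient_def
  by (rule continuous_on_vec_lambda) (auto intro: continuous_on_subset)

lemma gradient_inner:
  assumes "f differentiable (at x)"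
  shows "frechet_derivative f (at x) z = gradient f x \<bullet> z"
proof -
  interpret bounded_linear "frechet_derivative f (at x)"
    by (metis assms frechet_derivative_works has_derivative_bounded_linear)
  have "frechet_derivative f (at x) z = frechet_derivative f (at x) (\<Sum>i\<in>UNIV. z $ i *\<^sub>R axis i 1)"
    by (simp add: basis_expansion scalar_mult_eq_scaleR[symmetric])
  also have "\<dots> = (\<Sum>i\<in>UNIV. z $ i * frechet_derivative f (at x) (axis i 1))"
    by (simp add: sum scale)
  also have "\<dots> = gradient f x \<bullet> z"
    by (simp add: gradient_def partial_deriv_def inner_vec_def mult.commute)
  finally show ?thesis .
qed

lemma C_k_1_has_derivative: "C_k 1 f \<Longrightarrow> (f has_derivative (\<lambda>z. gradient f x \<bullet> z)) (at x)"
  by (metis C_k_1_differentiable frechet_derivative_works gradient_inner ext)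

lemma partial_deriv_diff:
  assumes "f differentiable (at x)" "g differentiable (at x)"
  shows "partial_deriv i (\<lambda>x. f x - g x) x = partial_deriv i f x - partial_deriv i g x"
proof -
  have "((\<lambda>x. f x - g x) has_derivative
      (\<lambda>z. frechet_derivative f (at x) z - frechet_derivative g (at x) z)) (at x)"
    using assms by (intro has_derivative_diff) (simp_all add: frechet_derivative_works[symmetric])
  from frechet_derivative_at[OF this] show ?thesis
    by (simp add: partial_deriv_def fun_eq_iff)
qed

lemma gradient_diff:
  "C_k 1 f \<Longrightarrow> C_k 1 g \<Longrightarrow> gradient (\<lambda>x. f x - g x) x = gradient f x - gradient g x"
  by (simp add: gradient_def vec_eq_iff partial_deriv_diff)

lemma C_k_diff: "C_k k f \<Longrightarrow> C_k k g \<Longrightarrow> C_k k (\<lambda>x. f x - g x)"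
proof (induction k arbitrary: f g)
  case 0
  then show ?case by (simp add: continuous_intros)
next
  case (Suc k)
  then have "partial_deriv i (\<lambda>x. f x - g x) = (\<lambda>x. partial_deriv i f x - partial_deriv i g x)" for i
    by (auto simp: partial_deriv_diff)
  with Suc show ?case by (auto intro: differentiable_diff)
qed

lemma gradient_eq_0_outside_support:
  assumes "x \<notin> closure {x. f x \<noteq> 0}"
  shows "gradient f x = 0"
proof -
  have "(f has_derivative (\<lambda>_. 0)) (at x)"
  proof (rule has_derivative_transform_within_open)
    show "((\<lambda>_. 0) has_derivative (\<lambda>_. 0)) (at x)" by simp
    show "open (- closure {x. f x \<noteq> 0})" by blast
    show "x \<in> - closure {x. f x \<noteq> 0}" using assms by blast
    show "0 = f y" if "y \<in> - closure {x. f x \<noteq> 0}" for y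
      by (metis (mono_tags, lifting) ComplD closure_subset mem_Collect_eq subsetD that)
  qed
  from frechet_derivative_at[OF this] have "frechet_derivative f (at x) z = 0" for z
    by metis
  then show ?thesis
    by (simp add: gradient_def partial_deriv_def vec_eq_iff)
qed

lemma test_function_C_k: "test_function \<Omega> \<phi> \<Longrightarrow> C_k k \<phi>"
  by (simp add: test_function_def)

lemma test_function_eq_0: "test_function \<Omega> \<phi> \<Longrightarrow> x \<notin> \<Omega> \<Longrightarrow> \<phi> x = 0"
  using closure_subset[of "{x. \<phi> x \<noteq> 0}"] by (auto simp: test_function_def)

lemma gradient_test_function_eq_0: "test_function \<Omega> \<phi> \<Longrightarrow> x \<notin> \<Omega> \<Longrightarrow> gradient \<phi> x = 0"
  by (rule gradient_eq_0_outside_support) (auto simp: test_function_def)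

lemma test_function_diff:
  assumes "test_function \<Omega> \<phi>" "test_function \<Omega> \<psi>"
  shows "test_function \<Omega> (\<lambda>x. \<phi> x - \<psi> x)"
proof -
  have "closure {x. \<phi> x - \<psi> x \<noteq> 0} \<subseteq> closure ({x. \<phi> x \<noteq> 0} \<union> {x. \<psi> x \<noteq> 0})"
    by (intro closure_mono) auto
  then have sub: "closure {x. \<phi> x - \<psi> x \<noteq> 0} \<subseteq> closure {x. \<phi> x \<noteq> 0} \<union> closure {x. \<psi> x \<noteq> 0}"
    by simp
  have "compact (closure {x. \<phi> x \<noteq> 0} \<union> closure {x. \<psi> x \<noteq> 0})"
    using assms unfolding test_function_def by (blast intro: compact_Un)
  from compact_Int_closed[OF this closed_closure[of "{x. \<phi> x - \<psi> x \<noteq> 0}"]] sub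
  have "compact (closure {x. \<phi> x - \<psi> x \<noteq> 0})"
    by (simp only: Int_absorb1)
  moreover have "closure {x. \<phi> x - \<psi> x \<noteq> 0} \<subseteq> \<Omega>"
    using sub assms unfolding test_function_def by blast
  moreover have "\<forall>k. C_k k (\<lambda>x. \<phi> x - \<psi> x)"
    using assms unfolding test_function_def by (blast intro: C_k_diff)
  ultimately show ?thesis
    unfolding test_function_def by blast
qed

section \<open>Test functions belong to the Sobolev space\<close>

lemma continuous_compact_support_integrable:
  fixes f :: "'a::euclidean_space \<Rightarrow> 'b::euclidean_space"
  assumes "continuous_on UNIV f" "compact K" "\<And>x. x \<notin> K \<Longrightarrow> f x = 0"
  shows "integrable lborel f"
proof -
  have "integrable lborel (\<lambda>x. indicator K x *\<^sub>R f x)"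
    by (rule borel_integrable_compact) (use assms in \<open>auto intro: continuous_on_subset\<close>)
  moreover have "(\<lambda>x. indicator K x *\<^sub>R f x) = f"
    using assms(3) by (auto simp: fun_eq_iff indicator_def)
  ultimately show ?thesis by simp
qed

lemma lebesgue_on_vanishing_outside:
  fixes f :: "'a::euclidean_space \<Rightarrow> 'b::euclidean_space"
  assumes "open \<Omega>" "f \<in> borel_measurable borel" "\<And>x. x \<notin> \<Omega> \<Longrightarrow> f x = 0"
  shows "integrable (lebesgue_on \<Omega>) f \<longleftrightarrow> integrable lborel f"
    and "integral\<^sup>L (lebesgue_on \<Omega>) f = integral\<^sup>L lborel f"
proof -
  have eq: "(\<lambda>x. indicator \<Omega> x *\<^sub>R f x) = f"
    using assms(3) by (auto simp: fun_eq_iff indicator_def)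
  have "\<Omega> \<in> sets lebesgue"
    using assms(1) by auto
  then show "integrable (lebesgue_on \<Omega>) f \<longleftrightarrow> integrable lborel f"
    "integral\<^sup>L (lebesgue_on \<Omega>) f = integral\<^sup>L lborel f"
    using assms(2) by (simp_all add: integrable_restrict_space integral_restrict_space eq
        integrable_completion integral_completion)
qed

lemma integral_translate_lborel:
  fixes f :: "'a::euclidean_space \<Rightarrow> real"
  assumes [measurable]: "f \<in> borel_measurable borel"
  shows "(\<integral>x. f (c + x) \<partial>lborel) = integral\<^sup>L lborel f"
proof -
  have "integral\<^sup>L lborel f = integral\<^sup>L (distr lborel borel ((+) c)) f"
    by (simp add: lborel_distr_plus)
  also have "\<dots> = (\<integral>x. f (c + x) \<partial>lborel)"
    by (rule integral_distr) auto
  finally show ?thesis by simp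
qed

lemma C_k_1_increment_integral:
  assumes "C_k 1 f"
  shows "((\<lambda>t. gradient f (x + t *\<^sub>R z) \<bullet> z) has_integral f (x + z) - f x) {0..1}"
proof -
  have "((\<lambda>t. f (x + t *\<^sub>R z)) has_vector_derivative gradient f (x + t *\<^sub>R z) \<bullet> z) (at t within {0..1})" for t
  proof -
    have "((\<lambda>t. f (x + t *\<^sub>R z)) has_derivative (\<lambda>s. gradient f (x + t *\<^sub>R z) \<bullet> (s *\<^sub>R z)))
        (at t within {0..1})"
      by (rule has_derivative_compose[OF _ C_k_1_has_derivative[OF assms], where f="\<lambda>t. x + t *\<^sub>R z"])
        (auto intro!: derivative_eq_intros)
    then show ?thesis by (simp add: has_vector_derivative_def)
  qed
  from fundamental_theorem_of_calculus[OF _ this] show ?thesis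
    by simp
qed

text \<open>The integral of a translate of \<open>f\<close> does not depend on the translation, so all difference
  quotients of \<open>f\<close> have integral 0; they converge to the derivative, and dominated convergence
  applies since they are bounded by \<open>sup |\<nabla>f|\<close> and supported in one compact set.\<close>

lemma integral_partial_deriv_eq_0:
  fixes f :: "real ^ 'n::finite \<Rightarrow> real"
  assumes f: "C_k 1 f" and K: "compact K" "\<And>x. x \<notin> K \<Longrightarrow> f x = 0"
  shows "(\<integral>x. partial_deriv i f x \<partial>lborel) = 0"
proof -
  define e :: "real ^ 'n" where "e = axis i 1"
  have [measurable]: "f \<in> borel_measurable borel"
    using C_k_1_continuous_on[OF f] by (rule borel_measurable_continuous_onI)
  have [measurable]: "partial_deriv i f \<in> borel_measurable borel"
    using f by (intro borel_measurable_continuous_onI) simp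
  have norm_e: "norm e = 1" by (simp add: e_def norm_axis_1)
  have int_f: "integrable lborel f"
    by (rule continuous_compact_support_integrable[OF C_k_1_continuous_on[OF f] K])
  obtain R where R: "\<And>x. x \<in> K \<Longrightarrow> norm x \<le> R"
    using compact_imp_bounded[OF K(1)] by (auto simp: bounded_iff)
  \<comment> \<open>A ball that contains all segments of length at most 1 starting within distance 1 of \<open>K\<close>.\<close>
  define L where "L = cball (0::real ^ 'n) (R + 2)"
  have "bounded (gradient f ` L)"
    by (intro compact_imp_bounded compact_continuous_image C_k_1_continuous_on_gradient f)
      (simp add: L_def)
  then obtain M where M: "\<And>x. x \<in> L \<Longrightarrow> norm (gradient f x) \<le> M"
    by (auto simp: bounded_iff)
  define h :: "nat \<Rightarrow> real" where "h n = inverse (real (Suc n))" for n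
  have h: "0 < h n" "h n \<le> 1" for n by (auto simp: h_def field_simps)
  define q where "q n x = (f (h n *\<^sub>R e + x) - f x) / h n" for n x
  have q0: "(\<integral>x. q n x \<partial>lborel) = 0" for n
  proof -
    have "integrable lborel (\<lambda>x. f (h n *\<^sub>R e + x))"
    proof -
      have "integrable (distr lborel borel ((+) (h n *\<^sub>R e))) f"
        using int_f by (simp add: lborel_distr_plus)
      then show ?thesis by (simp add: integrable_distr_eq)
    qed
    with int_f show ?thesis
      by (simp add: q_def integral_translate_lborel)
  qed
  have lim: "(\<lambda>n. q n x) \<longlonglongrightarrow> partial_deriv i f x" for x
  proof -
    have "((\<lambda>t. f (t *\<^sub>R e + x)) has_derivative (\<lambda>s. gradient f x \<bullet> (s *\<^sub>R e))) (at 0)"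
      by (rule has_derivative_compose[where f="\<lambda>t. t *\<^sub>R e + x"])
        (auto intro!: derivative_eq_intros C_k_1_has_derivative[OF f, simplified])
    then have "((\<lambda>t. f (t *\<^sub>R e + x)) has_real_derivative (gradient f x \<bullet> e)) (at 0)"
      unfolding has_field_derivative_def by (rule has_derivative_eq_rhs) (simp add: fun_eq_iff)
    then have "((\<lambda>t. (f (t *\<^sub>R e + x) - f x) / t) \<longlongrightarrow> gradient f x \<bullet> e) (at 0)"
      by (simp add: has_field_derivative_iff)
    moreover have "filterlim h (at 0) sequentially"
      unfolding h_def filterlim_at using LIMSEQ_inverse_real_of_nat by auto
    ultimately have "(\<lambda>n. q n x) \<longlonglongrightarrow> gradient f x \<bullet> e"
      unfolding q_def by (rule filterlim_compose)
    then show ?thesis by (simp add: gradient_def e_def inner_axis)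
  qed
  have bound: "norm (q n x) \<le> indicator L x *\<^sub>R M" for n x
  proof (cases "norm x \<le> R + 1")
    case True
    have inL: "x + t *\<^sub>R h n *\<^sub>R e \<in> L" if "t \<in> {0..1}" for t
    proof -
      have "t * h n \<le> 1" using that h[of n] by (simp add: mult_le_one)
      then have "norm (t *\<^sub>R h n *\<^sub>R e) \<le> 1"
        using that h[of n] by (simp add: norm_e abs_mult)
      then have "norm (x + t *\<^sub>R h n *\<^sub>R e) \<le> R + 2"
        using True norm_triangle_ineq[of x "t *\<^sub>R h n *\<^sub>R e"] by simp
      then show ?thesis by (simp add: L_def)
    qed
    have "norm (f (x + h n *\<^sub>R e) - f x) \<le> M * h n * measure lborel {0..1::real}"
    proof (rule has_integral_bound_real[where S="{}"])
      show "((\<lambda>t. gradient f (x + t *\<^sub>R h n *\<^sub>R e) \<bullet> (h n *\<^sub>R e)) has_integral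
          f (x + h n *\<^sub>R e) - f x) {0..1}"
        by (rule C_k_1_increment_integral[OF f])
      have "0 \<le> M" using order_trans[OF norm_ge_zero M[OF inL[of 0]]] by simp
      then show "0 \<le> M * h n" using h[of n] by simp
      show "norm (gradient f (x + t *\<^sub>R h n *\<^sub>R e) \<bullet> (h n *\<^sub>R e)) \<le> M * h n" if "t \<in> {0..1} - {}" for t
      proof -
        have "norm (gradient f (x + t *\<^sub>R h n *\<^sub>R e) \<bullet> (h n *\<^sub>R e))
            \<le> norm (gradient f (x + t *\<^sub>R h n *\<^sub>R e)) * norm (h n *\<^sub>R e)"
          by (simp only: real_norm_def Cauchy_Schwarz_ineq2)
        also have "\<dots> \<le> M * norm (h n *\<^sub>R e)"
          using that by (intro mult_right_mono M inL) auto
        finally show ?thesis using h[of n] by (simp add: norm_e)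
      qed
    qed simp
    moreover have "x \<in> L" using True by (simp add: L_def)
    ultimately show ?thesis using h[of n] by (simp add: q_def field_simps add.commute abs_mult)
  next
    case False
    have "norm (h n *\<^sub>R e + x) \<ge> norm x - 1"
      using norm_diff_ineq[of x "h n *\<^sub>R e"] h[of n] by (simp add: norm_e add.commute)
    with False have "h n *\<^sub>R e + x \<notin> K" "x \<notin> K" using R by force+
    then have "q n x = 0" using K by (simp add: q_def)
    moreover have "0 \<le> M" if "x \<in> L" using M[OF that] norm_ge_zero order_trans by blast
    ultimately show ?thesis by (auto simp: indicator_def)
  qed
  have "(\<lambda>n. \<integral>x. q n x \<partial>lborel) \<longlonglongrightarrow> (\<integral>x. partial_deriv i f x \<partial>lborel)"
  proof (rule integral_dominated_convergence[where w="\<lambda>x. indicator L x *\<^sub>R M"])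
    show "integrable lborel (\<lambda>x. indicator L x *\<^sub>R M)"
      by (intro borel_integrable_compact) (auto simp: L_def)
    show "q n \<in> borel_measurable lborel" for n unfolding q_def by measurable
  qed (use lim bound in auto)
  then have "(\<lambda>n. 0) \<longlonglongrightarrow> (\<integral>x. partial_deriv i f x \<partial>lborel)"
    by (simp only: q0)
  from LIMSEQ_unique[OF this tendsto_const] show ?thesis .
qed

lemma partial_deriv_mult:
  assumes "f differentiable (at x)" "g differentiable (at x)"
  shows "partial_deriv i (\<lambda>x. f x * g x) x = f x * partial_deriv i g x + partial_deriv i f x * g x"
proof -
  have "((\<lambda>x. f x * g x) has_derivative
      (\<lambda>z. f x * frechet_derivative g (at x) z + frechet_derivative f (at x) z * g x)) (at x)"
    using assms by (intro has_derivative_mult) (simp_all add: frechet_derivative_works[symmetric])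
  from frechet_derivative_at[OF this] show ?thesis
    by (simp add: partial_deriv_def fun_eq_iff)
qed

lemma continuous_locally_integrable:
  fixes f :: "real ^ 'n::finite \<Rightarrow> 'b::euclidean_space"
  assumes "continuous_on UNIV f"
  shows "locally_integrable \<Omega> f"
  unfolding locally_integrable_def set_integrable_def
proof (intro allI impI)
  fix K assume "compact K \<and> K \<subseteq> \<Omega>"
  then have "integrable lborel (\<lambda>x. indicator K x *\<^sub>R f x)"
    by (intro borel_integrable_compact) (use assms in \<open>auto intro: continuous_on_subset\<close>)
  then show "integrable lebesgue (\<lambda>x. indicator K x *\<^sub>R f x)"
    by (subst integrable_completion) (auto dest: borel_measurable_integrable)
qed

lemma test_function_in_L2:
  fixes \<Omega> :: "(real ^ 'n::finite) set"
  assumes "open \<Omega>" and v: "test_function \<Omega> v"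
  shows "in_L2 \<Omega> v" "in_L2 \<Omega> (gradient v)"
proof -
  have main: "in_L2 \<Omega> f" if f: "continuous_on UNIV f" "\<And>x. x \<notin> closure {x. v x \<noteq> 0} \<Longrightarrow> f x = 0"
    for f :: "real ^ 'n \<Rightarrow> 'b::euclidean_space"
  proof -
    have K: "compact (closure {x. v x \<noteq> 0})" "closure {x. v x \<noteq> 0} \<subseteq> \<Omega>"
      using v by (auto simp: test_function_def)
    have [measurable]: "f \<in> borel_measurable borel"
      using f(1) by (rule borel_measurable_continuous_onI)
    have "integrable lborel (\<lambda>x. (norm (f x))\<^sup>2)"
      by (rule continuous_compact_support_integrable[OF _ K(1)]) (auto intro!: continuous_intros f)
    then have "integrable (lebesgue_on \<Omega>) (\<lambda>x. (norm (f x))\<^sup>2)"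
      by (subst lebesgue_on_vanishing_outside) (use assms K f in auto)
    moreover have "f \<in> borel_measurable (lebesgue_on \<Omega>)"
      by (intro measurable_restrict_space1 measurable_completion) simp
    ultimately show ?thesis by (simp add: in_L2_def)
  qed
  show "in_L2 \<Omega> v"
    using closure_subset[of "{x. v x \<noteq> 0}"]
    by (intro main C_k_1_continuous_on[OF test_function_C_k[OF v]]) auto
  show "in_L2 \<Omega> (gradient v)"
    by (intro main C_k_1_continuous_on_gradient[OF test_function_C_k[OF v]] gradient_eq_0_outside_support)
qed

text \<open>Apply \<open>integral_partial_deriv_eq_0\<close> to the product of \<open>v\<close> with the function tested against;
  this is integration by parts.\<close>

lemma test_function_weak_gradient:
  fixes \<Omega> :: "(real ^ 'n::finite) set"
  assumes "open \<Omega>" and v: "test_function \<Omega> v"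
  shows "weak_gradient \<Omega> v (gradient v)"
  unfolding weak_gradient_def
proof (intro conjI allI impI)
  have C1v: "C_k 1 v" using v by (rule test_function_C_k)
  show "locally_integrable \<Omega> v" "locally_integrable \<Omega> (gradient v)"
    by (intro continuous_locally_integrable C_k_1_continuous_on C_k_1_continuous_on_gradient C1v)+
  fix \<phi> :: "real ^ 'n \<Rightarrow> real" and i assume \<phi>: "test_function \<Omega> \<phi>"
  define K where "K = closure {x. \<phi> x \<noteq> 0}"
  have K: "compact K" "K \<subseteq> \<Omega>"
    using \<phi> by (auto simp: K_def test_function_def)
  have C1\<phi>: "C_k 1 \<phi>" using \<phi> by (rule test_function_C_k)
  have \<phi>0: "\<phi> x = 0" "partial_deriv i \<phi> x = 0" if "x \<notin> K" for x
  proof -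
    show "\<phi> x = 0" using that closure_subset[of "{x. \<phi> x \<noteq> 0}"] unfolding K_def by blast
    show "partial_deriv i \<phi> x = 0"
      using gradient_eq_0_outside_support[of x \<phi>] that by (simp add: K_def gradient_def vec_eq_iff)
  qed
  have grad: "gradient v x $ i = partial_deriv i v x" for x by (simp add: gradient_def)
  have c: "continuous_on UNIV v" "continuous_on UNIV \<phi>"
      "continuous_on UNIV (partial_deriv i v)" "continuous_on UNIV (partial_deriv i \<phi>)"
    using C_k_1_continuous_on[OF C1v] C_k_1_continuous_on[OF C1\<phi>] C1v C1\<phi> by auto
  let ?f = "\<lambda>x. v x * partial_deriv i \<phi> x" and ?g = "\<lambda>x. partial_deriv i v x * \<phi> x"
  have int: "integrable lborel ?f" "integrable lborel ?g"
    by (rule continuous_compact_support_integrable[OF _ K(1)]; use c \<phi>0 in \<open>auto intro!: continuous_intros\<close>)+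
  have pd: "partial_deriv i (\<lambda>x. v x * \<phi> x) = (\<lambda>x. v x * partial_deriv i \<phi> x + partial_deriv i v x * \<phi> x)" for i
    by (rule ext, rule partial_deriv_mult) (use C1v C1\<phi> in auto)
  have "C_k 1 (\<lambda>x. v x * \<phi> x)"
    using C1v C1\<phi> c C_k_1_continuous_on[OF C1v] C_k_1_continuous_on[OF C1\<phi>]
    by (auto simp: pd intro!: continuous_intros)
  then have "(\<integral>x. ?f x + ?g x \<partial>lborel) = 0"
    using integral_partial_deriv_eq_0[of "\<lambda>x. v x * \<phi> x" K i] K(1) \<phi>0 by (simp add: pd)
  then have "integral\<^sup>L lborel ?f = - integral\<^sup>L lborel ?g"
    using int by (simp add: add_eq_0_iff)
  moreover have "integral\<^sup>L (lebesgue_on \<Omega>) ?f = integral\<^sup>L lborel ?f"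
      "integral\<^sup>L (lebesgue_on \<Omega>) ?g = integral\<^sup>L lborel ?g"
    by (rule lebesgue_on_vanishing_outside; use assms K \<phi>0 int in \<open>auto dest: borel_measurable_integrable\<close>)+
  ultimately show "integral\<^sup>L (lebesgue_on \<Omega>) (\<lambda>x. v x * partial_deriv i \<phi> x) =
      - integral\<^sup>L (lebesgue_on \<Omega>) (\<lambda>x. gradient v x $ i * \<phi> x)"
    by (simp add: grad)
qed

text \<open>Hardy's inequality is stated for the Sobolev space, but it is used for smooth functions only.\<close>

lemma test_function_in_H1_0:
  fixes \<Omega> :: "(real ^ 'n::finite) set"
  assumes "open \<Omega>" "test_function \<Omega> v"
  shows "v \<in> H1_0 \<Omega>"
  unfolding H1_0_def
  using test_function_in_L2[OF assms] test_function_weak_gradient[OF assms] assms(2)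
  by (auto simp: L2_norm_def intro!: exI[of _ "gradient v"] exI[of _ "\<lambda>_. v"])

section \<open>Integrals over the plane\<close>

lemma ball_in_sets_borel [measurable]: "ball (c :: 'a::metric_space) r \<in> sets borel"
  by (rule borel_open) (rule open_ball)

lemma nn_integral_affine:
  fixes f :: "'a::euclidean_space \<Rightarrow> ennreal"
  assumes [measurable]: "f \<in> borel_measurable borel" and "c \<noteq> 0"
  shows "(\<integral>\<^sup>+x. f x \<partial>lborel) = ennreal (\<bar>c\<bar> ^ DIM('a)) * (\<integral>\<^sup>+x. f (t + c *\<^sub>R x) \<partial>lborel)"
proof -
  have "(\<integral>\<^sup>+x. f x \<partial>lborel) =
      (\<integral>\<^sup>+x. f x \<partial>density (distr lborel borel (\<lambda>x. t + c *\<^sub>R x)) (\<lambda>_. \<bar>c\<bar> ^ DIM('a)))"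
    using lborel_affine[OF assms(2), of t] by simp
  also have "\<dots> = ennreal (\<bar>c\<bar> ^ DIM('a)) * (\<integral>\<^sup>+x. f (t + c *\<^sub>R x) \<partial>lborel)"
    by (simp add: nn_integral_density nn_integral_distr nn_integral_cmult)
  finally show ?thesis .
qed

lemma emeasure_cball_plane: "0 \<le> r \<Longrightarrow> emeasure lborel (cball (c :: real ^ 2) r) = ennreal (pi * r\<^sup>2)"
  by (simp add: emeasure_cball unit_ball_vol_2)

lemma emeasure_ball_plane: "0 \<le> r \<Longrightarrow> emeasure lborel (ball (c :: real ^ 2) r) = ennreal (pi * r\<^sup>2)"
  by (simp add: emeasure_ball unit_ball_vol_2)

lemma Tonelli_lborel:
  fixes f :: "'a::euclidean_space \<Rightarrow> 'b::euclidean_space \<Rightarrow> ennreal"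
  assumes "case_prod f \<in> borel_measurable (borel \<Otimes>\<^sub>M borel)"
  shows "(\<integral>\<^sup>+x. (\<integral>\<^sup>+y. f x y \<partial>lborel) \<partial>lborel) = (\<integral>\<^sup>+y. (\<integral>\<^sup>+x. f x y \<partial>lborel) \<partial>lborel)"
proof -
  have "case_prod f \<in> borel_measurable (lborel \<Otimes>\<^sub>M lborel)"
    using assms by (simp cong: measurable_cong_sets sets_pair_measure_cong)
  then show ?thesis
    by (rule lborel_pair.Fubini'[symmetric])
qed

text \<open>Layer cake: for \<open>s = 2 - a\<close> write \<open>|y| powr -s\<close> as \<open>r powr -s\<close> plus the integral of
  \<open>s * t powr (-s - 1)\<close> over \<open>|y| \<le> t \<le> r\<close> and integrate over \<open>y\<close> first.\<close>

lemma nn_integral_ball_norm_powr: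
  assumes a: "0 < a" "a \<le> 2" and r: "0 < r"
  shows "(\<integral>\<^sup>+y. ennreal (norm (y :: real ^ 2) powr (a - 2)) * indicator (ball 0 r) y \<partial>lborel)
    \<le> ennreal (2 * pi * r powr a / a)"
proof -
  define J where "J t y = ennreal ((2 - a) * t powr (a - 3)) * indicator {0..r} t * indicator (cball 0 t) y"
    for t and y :: "real ^ 2"
  have J_if: "J = (\<lambda>t y. if 0 \<le> t \<and> t \<le> r \<and> norm y \<le> t then ennreal ((2 - a) * t powr (a - 3)) else 0)"
    by (auto simp: J_def fun_eq_iff indicator_def)
  have J_pair: "case_prod J \<in> borel_measurable (borel \<Otimes>\<^sub>M borel)"
    unfolding J_if by measurable
  have J_pair': "(\<lambda>(y, t). J t y) \<in> borel_measurable (borel \<Otimes>\<^sub>M borel)"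
    unfolding J_if by measurable
  have J_int: "(\<lambda>y. \<integral>\<^sup>+t. J t y \<partial>lborel) \<in> borel_measurable lborel"
    using lborel.borel_measurable_nn_integral[of "\<lambda>y t. J t y" borel] J_pair'
    by (simp cong: measurable_cong_sets sets_pair_measure_cong)
  have layer: "ennreal (norm y powr (a - 2)) * indicator (ball 0 r) y
      \<le> ennreal (r powr (a - 2)) * indicator (ball 0 r) y
        + (\<integral>\<^sup>+t. J t y \<partial>lborel)"
    for y :: "real ^ 2"
  proof (cases "y \<in> ball 0 r \<and> y \<noteq> 0")
    case True
    then have y: "0 < norm y" "norm y < r" by auto
    have "((\<lambda>t. (2 - a) * t powr (a - 3)) has_integral norm y powr (a - 2) - r powr (a - 2)) {norm y..r}"
    proof -
      have "((\<lambda>t. (2 - a) * t powr (a - 3)) has_integral - (r powr (a - 2)) - - (norm y powr (a - 2))) {norm y..r}"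
      proof (rule fundamental_theorem_of_calculus)
        fix t assume "t \<in> {norm y..r}"
        then have t: "0 < t" using y by (meson atLeastAtMost_iff less_le_trans)
        have "((\<lambda>t. - (t powr (a - 2))) has_real_derivative (2 - a) * t powr (a - 3)) (at t within {norm y..r})"
          using t by (auto intro!: derivative_eq_intros simp: algebra_simps)
        then show "((\<lambda>t. - (t powr (a - 2))) has_vector_derivative (2 - a) * t powr (a - 3)) (at t within {norm y..r})"
          by (simp add: has_real_derivative_iff_has_vector_derivative)
      qed (use y in simp)
      then show ?thesis by simp
    qed
    then have "(\<integral>\<^sup>+t. ennreal ((2 - a) * t powr (a - 3)) * indicator {norm y..r} t \<partial>lborel)
        = ennreal (norm y powr (a - 2) - r powr (a - 2))"
      by (rule nn_integral_has_integral_lebesgue'[rotated]) (use a in simp)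
    moreover have "(\<integral>\<^sup>+t. ennreal ((2 - a) * t powr (a - 3)) * indicator {norm y..r} t \<partial>lborel)
        = (\<integral>\<^sup>+t. J t y \<partial>lborel)"
      by (intro nn_integral_cong) (auto simp: J_def indicator_def intro: order_trans[OF norm_ge_zero])
    moreover have "r powr (a - 2) \<le> norm y powr (a - 2)"
      using powr_mono2'[of "a - 2" "norm y" r] a y by simp
    ultimately show ?thesis
      using True by (simp flip: ennreal_plus)
  next
    case False
    then show ?thesis by (auto simp: indicator_def)
  qed
  have "(\<integral>\<^sup>+y. ennreal (norm (y :: real ^ 2) powr (a - 2)) * indicator (ball 0 r) y \<partial>lborel)
      \<le> (\<integral>\<^sup>+y. ennreal (r powr (a - 2)) * indicator (ball 0 r) y
        + (\<integral>\<^sup>+t. J t y \<partial>lborel)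
        \<partial>(lborel :: (real ^ 2) measure))"
    by (intro nn_integral_mono layer)
  also have "\<dots> = ennreal (r powr (a - 2)) * ennreal (pi * r\<^sup>2)
      + (\<integral>\<^sup>+y. (\<integral>\<^sup>+t. J t y \<partial>lborel)
        \<partial>(lborel :: (real ^ 2) measure))"
  proof -
    have "(\<integral>\<^sup>+y. ennreal (r powr (a - 2)) * indicator (ball (0 :: real ^ 2) r) y \<partial>lborel)
        = ennreal (r powr (a - 2)) * ennreal (pi * r\<^sup>2)"
      using r by (subst nn_integral_cmult_indicator) (simp_all add: emeasure_ball_plane)
    moreover have "(\<lambda>y. ennreal (r powr (a - 2)) * indicator (ball (0 :: real ^ 2) r) y) \<in> borel_measurable lborel"
      by (rule borel_measurable_times_ennreal[OF borel_measurable_const borel_measurable_indicator])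
        (simp only: sets_lborel borel_open open_ball)
    ultimately show ?thesis by (simp only: nn_integral_add[OF _ J_int])
  qed
  also have "(\<integral>\<^sup>+y. (\<integral>\<^sup>+t. J t y \<partial>lborel)
        \<partial>(lborel :: (real ^ 2) measure))
      = (\<integral>\<^sup>+t. (\<integral>\<^sup>+y. J t y
        \<partial>(lborel :: (real ^ 2) measure)) \<partial>lborel)"
    by (rule Tonelli_lborel[OF J_pair'])
  also have "\<dots> = (\<integral>\<^sup>+t. ennreal ((2 - a) * pi * t powr (a - 1)) * indicator {0..r} t \<partial>lborel)"
  proof (rule nn_integral_cong)
    fix t :: real
    show "(\<integral>\<^sup>+y. J t y
        \<partial>(lborel :: (real ^ 2) measure)) = ennreal ((2 - a) * pi * t powr (a - 1)) * indicator {0..r} t"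
    proof (cases "t \<in> {0..r}")
      case True
      have "t powr (a - 3) * t\<^sup>2 = t powr (a - 1)"
      proof (cases "t = 0")
        case False
        then have "t\<^sup>2 = t powr 2" using True by simp
        then show ?thesis by (simp flip: powr_add)
      qed simp
      then have "(2 - a) * t powr (a - 3) * (pi * t\<^sup>2) = (2 - a) * pi * t powr (a - 1)"
        by (metis (no_types, lifting) mult.assoc mult.commute)
      then have "ennreal ((2 - a) * t powr (a - 3)) * ennreal (pi * t\<^sup>2) = ennreal ((2 - a) * pi * t powr (a - 1))"
        using a by (metis ennreal_mult' diff_ge_0_iff_ge mult_nonneg_nonneg powr_ge_zero)
      moreover have "(\<integral>\<^sup>+y. J t y \<partial>lborel) = ennreal ((2 - a) * t powr (a - 3)) * ennreal (pi * t\<^sup>2)"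
        using True by (simp add: J_def nn_integral_cmult_indicator emeasure_cball_plane)
      ultimately show ?thesis
        using True by simp
    qed (simp add: J_def)
  qed
  also have "\<dots> = ennreal ((2 - a) * pi * (r powr a / a))"
  proof (rule nn_integral_has_integral_lebesgue')
    show "((\<lambda>t. (2 - a) * pi * t powr (a - 1)) has_integral (2 - a) * pi * (r powr a / a)) {0..r}"
      using has_integral_mult_right[OF has_integral_powr_from_0[of "a - 1" r], of "(2 - a) * pi"] a r by simp
  qed (use a in auto)
  also have "ennreal (r powr (a - 2)) * ennreal (pi * r\<^sup>2) = ennreal (pi * r powr a)"
  proof -
    have "r powr (a - 2) * r\<^sup>2 = r powr a"
      using r powr_add[of r "a - 2" 2] by simp
    then have "r powr (a - 2) * (pi * r\<^sup>2) = pi * r powr a" by (simp add: mult.left_commute)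
    then show ?thesis by (simp flip: ennreal_mult)
  qed
  also have "ennreal (pi * r powr a) + ennreal ((2 - a) * pi * (r powr a / a)) = ennreal (2 * pi * r powr a / a)"
  proof -
    have "pi * r powr a + (2 - a) * pi * (r powr a / a) = 2 * pi * r powr a / a"
      using a by (simp add: field_simps)
    then show ?thesis using a by (simp flip: ennreal_plus)
  qed
  finally show ?thesis .
qed

text \<open>Jensen's inequality for powers and the measure with density \<open>p\<close>, in a homogeneous form that allows
  any total mass. Let \<open>m\<^sub>j\<close> be the integral of \<open>p f\<^sup>j\<close>. Integrating
  \<open>a b\<^sup>j + b a\<^sup>j \<le> a\<^sup>j\<^sup>+\<^sup>1 + b\<^sup>j\<^sup>+\<^sup>1\<close> with \<open>a = f x\<close>, \<open>b = f y\<close> against \<open>p x\<close> and \<open>p y\<close> gives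
  \<open>m\<^sub>1 m\<^sub>j \<le> m\<^sub>0 m\<^sub>j\<^sub>+\<^sub>1\<close>, which is the induction step.\<close>

lemma nn_integral_power_mean:
  fixes f p :: "'a \<Rightarrow> ennreal"
  assumes [measurable]: "f \<in> borel_measurable M" "p \<in> borel_measurable M"
  shows "(\<integral>\<^sup>+x. p x * f x \<partial>M) ^ Suc k \<le> (\<integral>\<^sup>+x. p x \<partial>M) ^ k * (\<integral>\<^sup>+x. p x * f x ^ Suc k \<partial>M)"
proof (induction k)
  case 0
  then show ?case by simp
next
  case (Suc k)
  define m where "m j = (\<integral>\<^sup>+x. p x * f x ^ j \<partial>M)" for j
  have rearr: "a * b ^ j + b * a ^ j \<le> a ^ Suc j + b ^ Suc j" for a b :: ennreal and j
  proof -
    have *: "a * b ^ j + b * a ^ j \<le> a ^ Suc j + b ^ Suc j" if "a \<le> b" for a b :: ennreal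
    proof -
      from that obtain d where d: "b = a + d" by (auto simp: le_iff_add)
      have "a * b ^ j + b * a ^ j = a * b ^ j + a ^ Suc j + d * a ^ j"
        by (simp add: d algebra_simps)
      also have "\<dots> \<le> a * b ^ j + a ^ Suc j + d * b ^ j"
        using that by (intro add_left_mono mult_left_mono power_mono) auto
      also have "\<dots> = a ^ Suc j + b ^ Suc j"
        by (simp add: d algebra_simps)
      finally show ?thesis .
    qed
    show ?thesis
      using *[of a b] *[of b a] by (cases a b rule: linorder_le_cases) (auto simp: add.commute)
  qed
  have step: "a * m j + a ^ j * m 1 \<le> a ^ Suc j * m 0 + m (Suc j)" for a j
  proof -
    have "a * m j + a ^ j * m 1 = (\<integral>\<^sup>+x. a * (p x * f x ^ j) + a ^ j * (p x * f x ^ 1) \<partial>M)"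
      by (simp add: m_def nn_integral_add nn_integral_cmult)
    also have "\<dots> = (\<integral>\<^sup>+x. p x * (a * f x ^ j + f x * a ^ j) \<partial>M)"
      by (simp add: distrib_left mult_ac)
    also have "\<dots> \<le> (\<integral>\<^sup>+x. p x * (a ^ Suc j + f x ^ Suc j) \<partial>M)"
      by (intro nn_integral_mono mult_left_mono rearr) simp
    also have "\<dots> = (\<integral>\<^sup>+x. a ^ Suc j * (p x * f x ^ 0) + p x * f x ^ Suc j \<partial>M)"
      by (simp add: distrib_left mult_ac)
    also have "\<dots> = a ^ Suc j * m 0 + m (Suc j)"
      by (simp add: m_def nn_integral_add nn_integral_cmult del: power_Suc power_0)
    finally show ?thesis .
  qed
  have double: "m 1 * m j + m j * m 1 \<le> m (Suc j) * m 0 + m 0 * m (Suc j)" for j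
  proof -
    have "m 1 * m j + m j * m 1 = (\<integral>\<^sup>+x. p x * f x ^ 1 * m j + p x * f x ^ j * m 1 \<partial>M)"
      by (subst nn_integral_add) (simp_all add: nn_integral_multc m_def)
    also have "\<dots> = (\<integral>\<^sup>+x. p x * (f x * m j + f x ^ j * m 1) \<partial>M)"
      by (simp add: distrib_left mult_ac)
    also have "\<dots> \<le> (\<integral>\<^sup>+x. p x * (f x ^ Suc j * m 0 + m (Suc j)) \<partial>M)"
      by (intro nn_integral_mono mult_left_mono step) simp
    also have "\<dots> = (\<integral>\<^sup>+x. p x * f x ^ Suc j * m 0 + p x * f x ^ 0 * m (Suc j) \<partial>M)"
      by (simp add: distrib_left mult_ac)
    also have "\<dots> = m (Suc j) * m 0 + m 0 * m (Suc j)"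
      by (subst nn_integral_add) (simp_all add: nn_integral_multc m_def)
    finally show ?thesis .
  qed
  have chebyshev: "m 1 * m j \<le> m 0 * m (Suc j)" for j
  proof -
    have "2 * (m 1 * m j) \<le> 2 * (m 0 * m (Suc j))"
      using double[of j] by (simp add: mult_2 mult.commute)
    then show ?thesis by (simp add: ennreal_mult_le_mult_iff)
  qed
  have "m 1 ^ Suc (Suc k) = m 1 * m 1 ^ Suc k" by simp
  also have "\<dots> \<le> m 1 * (m 0 ^ k * m (Suc k))"
    using Suc.IH by (intro mult_left_mono) (auto simp: m_def)
  also have "\<dots> = m 0 ^ k * (m 1 * m (Suc k))"
    by (simp add: mult_ac)
  also have "\<dots> \<le> m 0 ^ k * (m 0 * m (Suc (Suc k)))"
    by (intro mult_left_mono chebyshev) simp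
  also have "\<dots> = m 0 ^ Suc k * m (Suc (Suc k))"
    by (simp add: mult_ac)
  finally show ?case by (simp add: m_def)
qed

section \<open>A pointwise bound by a truncated Riesz potential\<close>

lemma C_k_1_abs_le_line_integral:
  fixes f :: "real ^ 'n::finite \<Rightarrow> real"
  assumes f: "C_k 1 f"
  shows "ennreal \<bar>f x\<bar> \<le> ennreal \<bar>f (x + z)\<bar>
    + (\<integral>\<^sup>+t. ennreal (norm (gradient f (x + t *\<^sub>R z)) * norm z) * indicator {0<..1} t \<partial>lborel)"
proof -
  let ?g = "\<lambda>t. norm (gradient f (x + t *\<^sub>R z)) * norm z"
  have "?g integrable_on {0..1}"
    by (intro integrable_continuous_real continuous_intros
        continuous_on_compose2[OF C_k_1_continuous_on_gradient[OF f, of UNIV]]) auto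
  then obtain I where I: "(?g has_integral I) {0..1}" by (auto simp: integrable_on_def)
  have "norm (f (x + z) - f x) \<le> I"
    unfolding integral_unique[OF C_k_1_increment_integral[OF f], symmetric] integral_unique[OF I, symmetric]
    by (rule integral_norm_bound_integral)
      (use I C_k_1_increment_integral[OF f] Cauchy_Schwarz_ineq2 in auto)
  moreover have "(\<integral>\<^sup>+t. ennreal (?g t) * indicator {0..1} t \<partial>lborel) = ennreal I"
    by (rule nn_integral_has_integral_lebesgue'[OF _ I]) simp
  moreover have "(\<integral>\<^sup>+t. ennreal (?g t) * indicator {0..1} t \<partial>lborel)
      = (\<integral>\<^sup>+t. ennreal (?g t) * indicator {0<..1} t \<partial>lborel)"
    by (rule nn_integral_cong_AE) (use AE_lborel_singleton[of "0::real"] in eventually_elim, auto simp: indicator_def)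
  moreover have "0 \<le> I" using calculation(1) norm_ge_zero order_trans by blast
  ultimately show ?thesis
    by (simp flip: ennreal_plus)
qed

lemma nn_integral_dilated_ball:
  fixes f :: "real ^ 2 \<Rightarrow> real"
  assumes [measurable]: "f \<in> borel_measurable borel" and f: "\<And>y. 0 \<le> f y" and t: "0 < t"
  shows "(\<integral>\<^sup>+z. ennreal (f (t *\<^sub>R z) * norm z) * indicator (ball 0 r) z \<partial>lborel)
    = (\<integral>\<^sup>+y. ennreal (f y * norm y / t ^ 3) * indicator (ball 0 (t * r)) y \<partial>lborel)"
proof -
  let ?F = "\<lambda>y. ennreal (f y * norm y / t) * indicator (ball 0 (t * r)) y"
  have "ennreal (1 / t\<^sup>2) * (\<integral>\<^sup>+y. ?F y \<partial>lborel)
      = ennreal (1 / t\<^sup>2) * (ennreal (t\<^sup>2) * (\<integral>\<^sup>+z. ?F (0 + t *\<^sub>R z) \<partial>lborel))"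
    using t by (subst nn_integral_affine[of ?F t 0]) auto
  also have "\<dots> = (\<integral>\<^sup>+z. ?F (0 + t *\<^sub>R z) \<partial>lborel)"
    using t by (simp add: mult.assoc[symmetric] flip: ennreal_mult)
  also have "\<dots> = (\<integral>\<^sup>+z. ennreal (f (t *\<^sub>R z) * norm z) * indicator (ball 0 r) z \<partial>lborel)"
    using t by (intro nn_integral_cong) (auto simp: indicator_def)
  also have "ennreal (1 / t\<^sup>2) * (\<integral>\<^sup>+y. ?F y \<partial>lborel) = (\<integral>\<^sup>+y. ennreal (1 / t\<^sup>2) * ?F y \<partial>lborel)"
    by (simp add: nn_integral_cmult)
  also have "\<dots> = (\<integral>\<^sup>+y. ennreal (f y * norm y / t ^ 3) * indicator (ball 0 (t * r)) y \<partial>lborel)"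
    using t f by (intro nn_integral_cong)
      (simp add: mult.assoc[symmetric] power2_eq_square power3_eq_cube flip: ennreal_mult)
  finally show ?thesis by simp
qed

lemma nn_integral_inverse_cube:
  assumes "0 < \<rho>" "\<rho> \<le> 1" "0 \<le> c"
  shows "(\<integral>\<^sup>+t. ennreal (c / t ^ 3) * indicator {\<rho>..1} t \<partial>lborel) \<le> ennreal (c / (2 * \<rho>\<^sup>2))"
proof -
  have "((\<lambda>t. c / t ^ 3) has_integral (- c / (2 * 1\<^sup>2)) - (- c / (2 * \<rho>\<^sup>2))) {\<rho>..1}"
  proof (rule fundamental_theorem_of_calculus)
    fix t assume "t \<in> {\<rho>..1}"
    then have "0 < t" using assms(1) by (meson atLeastAtMost_iff less_le_trans)
    then have "((\<lambda>t. - c / (2 * t\<^sup>2)) has_real_derivative c / t ^ 3) (at t within {\<rho>..1})"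
      by (auto intro!: derivative_eq_intros simp: field_simps power2_eq_square power3_eq_cube)
    then show "((\<lambda>t. - c / (2 * t\<^sup>2)) has_vector_derivative c / t ^ 3) (at t within {\<rho>..1})"
      by (simp add: has_real_derivative_iff_has_vector_derivative)
  qed (use assms in simp)
  then have "(\<integral>\<^sup>+t. ennreal (c / t ^ 3) * indicator {\<rho>..1} t \<partial>lborel)
      = ennreal ((- c / (2 * 1\<^sup>2)) - (- c / (2 * \<rho>\<^sup>2)))"
    by (rule nn_integral_has_integral_lebesgue'[rotated]) (use assms in auto)
  also have "\<dots> \<le> ennreal (c / (2 * \<rho>\<^sup>2))"
    using assms(3) by (intro ennreal_leI) simp
  finally show ?thesis .
qed

text \<open>Average the line integral bound over all endpoints \<open>x + z\<close> in a ball, and substitute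
  \<open>y = t z\<close>: a point \<open>y\<close> is met for the parameters \<open>t > |y| / r\<close>, with weight \<open>|y| / t\<^sup>3\<close>.\<close>

lemma abs_le_ball_average:
  fixes v :: "real ^ 2 \<Rightarrow> real"
  assumes v: "C_k 1 v" and r: "0 < r"
  shows "ennreal (pi * r\<^sup>2 * \<bar>v x\<bar>)
    \<le> (\<integral>\<^sup>+y. ennreal \<bar>v (x + y)\<bar> * indicator (ball 0 r) y \<partial>lborel)
      + (\<integral>\<^sup>+y. ennreal (r\<^sup>2 / 2 * norm (gradient v (x + y)) / norm y) * indicator (ball 0 r) y \<partial>lborel)"
proof -
  define h where "h y = norm (gradient v (x + y))" for y
  have [measurable]: "v \<in> borel_measurable borel" "gradient v \<in> borel_measurable borel"
    by (intro borel_measurable_continuous_onI C_k_1_continuous_on C_k_1_continuous_on_gradient v)+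
  have [measurable]: "h \<in> borel_measurable borel"
    unfolding h_def by measurable
  have h0: "0 \<le> h y" for y by (simp add: h_def)
  have swap: "(\<integral>\<^sup>+z. (\<integral>\<^sup>+t. ennreal (h (t *\<^sub>R z) * norm z) * indicator {0<..1} t \<partial>lborel)
        * indicator (ball 0 r) z \<partial>lborel)
      \<le> (\<integral>\<^sup>+y. ennreal (r\<^sup>2 / 2 * h y / norm y) * indicator (ball 0 r) y \<partial>lborel)"
  proof -
    have "(\<integral>\<^sup>+z. (\<integral>\<^sup>+t. ennreal (h (t *\<^sub>R z) * norm z) * indicator {0<..1} t \<partial>lborel)
        * indicator (ball 0 r) z \<partial>lborel)
      = (\<integral>\<^sup>+z. (\<integral>\<^sup>+t. ennreal (h (t *\<^sub>R z) * norm z) * indicator {0<..1} t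
        * indicator (ball 0 r) z \<partial>lborel) \<partial>lborel)"
      by (intro nn_integral_cong nn_integral_multc[symmetric]) measurable
    also have "\<dots> = (\<integral>\<^sup>+t. (\<integral>\<^sup>+z. ennreal (h (t *\<^sub>R z) * norm z) * indicator {0<..1} t
        * indicator (ball 0 r) z \<partial>lborel) \<partial>lborel)"
      by (rule Tonelli_lborel) measurable
    also have "\<dots> = (\<integral>\<^sup>+t. (\<integral>\<^sup>+y. ennreal (h y * norm y / t ^ 3) * indicator {0<..1} t
        * indicator (ball 0 (t * r)) y \<partial>lborel) \<partial>lborel)"
    proof (rule nn_integral_cong)
      fix t :: real
      show "(\<integral>\<^sup>+z. ennreal (h (t *\<^sub>R z) * norm z) * indicator {0<..1} t * indicator (ball 0 r) z \<partial>lborel)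
        = (\<integral>\<^sup>+y. ennreal (h y * norm y / t ^ 3) * indicator {0<..1} t * indicator (ball 0 (t * r)) y \<partial>lborel)"
        using nn_integral_dilated_ball[of h t r] h0 by (cases "t \<in> {0<..1}") simp_all
    qed
    also have "\<dots> = (\<integral>\<^sup>+t. (\<integral>\<^sup>+y. (if 0 < t \<and> t \<le> 1 \<and> norm y < t * r then ennreal (h y * norm y / t ^ 3) else 0)
        \<partial>lborel) \<partial>lborel)"
      by (intro nn_integral_cong) (auto simp: indicator_def)
    also have "\<dots> = (\<integral>\<^sup>+y. (\<integral>\<^sup>+t. (if 0 < t \<and> t \<le> 1 \<and> norm y < t * r then ennreal (h y * norm y / t ^ 3) else 0)
        \<partial>lborel) \<partial>lborel)"
      by (rule Tonelli_lborel) measurable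
    also have "\<dots> \<le> (\<integral>\<^sup>+y. ennreal (r\<^sup>2 / 2 * h y / norm y) * indicator (ball 0 r) y \<partial>lborel)"
    proof (rule nn_integral_mono)
      fix y :: "real ^ 2"
      let ?I = "\<integral>\<^sup>+t. (if 0 < t \<and> t \<le> 1 \<and> norm y < t * r then ennreal (h y * norm y / t ^ 3) else 0) \<partial>lborel"
      consider "y = 0" | "r \<le> norm y" | "y \<noteq> 0" "norm y < r" by linarith
      then show "?I \<le> ennreal (r\<^sup>2 / 2 * h y / norm y) * indicator (ball 0 r) y"
      proof cases
        case 1
        then have "?I = (\<integral>\<^sup>+t. 0 \<partial>(lborel :: real measure))" by (intro nn_integral_cong) simp
        then show ?thesis by simp
      next
        case 2
        have "t * r \<le> r" if "t \<le> 1" for t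
          using mult_right_mono[OF that, of r] r by simp
        with 2 have "(0 < t \<and> t \<le> 1 \<and> norm y < t * r) = False" for t
          by (meson linorder_not_less order_trans)
        then show ?thesis by (simp only: if_False) simp
      next
        case 3
        then have \<rho>: "0 < norm y / r" "norm y / r \<le> 1" using r by simp_all
        have "?I \<le> (\<integral>\<^sup>+t. ennreal ((h y * norm y) / t ^ 3) * indicator {norm y / r..1} t \<partial>lborel)"
          using r by (intro nn_integral_mono) (auto simp: indicator_def field_simps)
        also have "\<dots> \<le> ennreal (h y * norm y / (2 * (norm y / r)\<^sup>2))"
          by (rule nn_integral_inverse_cube) (use \<rho> h0 in auto)
        also have "h y * norm y / (2 * (norm y / r)\<^sup>2) = r\<^sup>2 / 2 * h y / norm y"
          using 3 r by (simp add: field_simps power2_eq_square)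
        finally show ?thesis using 3 by simp
      qed
    qed
    finally show ?thesis .
  qed
  have "ennreal (pi * r\<^sup>2 * \<bar>v x\<bar>) = (\<integral>\<^sup>+z. ennreal \<bar>v x\<bar> * indicator (ball (0 :: real ^ 2) r) z \<partial>lborel)"
    using r by (simp add: nn_integral_cmult_indicator emeasure_ball_plane mult.commute flip: ennreal_mult)
  also have "\<dots> \<le> (\<integral>\<^sup>+z. ennreal \<bar>v (x + z)\<bar> * indicator (ball 0 r) z
      + (\<integral>\<^sup>+t. ennreal (h (t *\<^sub>R z) * norm z) * indicator {0<..1} t \<partial>lborel) * indicator (ball 0 r) z \<partial>lborel)"
    unfolding distrib_right[symmetric] h_def
    by (intro nn_integral_mono mult_right_mono C_k_1_abs_le_line_integral v) simp
  also have "\<dots> = (\<integral>\<^sup>+z. ennreal \<bar>v (x + z)\<bar> * indicator (ball 0 r) z \<partial>lborel)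
      + (\<integral>\<^sup>+z. (\<integral>\<^sup>+t. ennreal (h (t *\<^sub>R z) * norm z) * indicator {0<..1} t \<partial>lborel)
        * indicator (ball 0 r) z \<partial>lborel)"
    by (rule nn_integral_add) measurable
  also have "\<dots> \<le> (\<integral>\<^sup>+z. ennreal \<bar>v (x + z)\<bar> * indicator (ball 0 r) z \<partial>lborel)
      + (\<integral>\<^sup>+y. ennreal (r\<^sup>2 / 2 * h y / norm y) * indicator (ball 0 r) y \<partial>lborel)"
    by (intro add_left_mono swap)
  finally show ?thesis by (simp add: h_def)
qed

text \<open>The two terms of the ball average are put over the common kernel \<open>1 / |y|\<close>: in the ball,
  \<open>1 / r \<le> 1 / |y|\<close> except at the centre, a null set, where division by zero makes the kernel vanish.\<close>

lemma abs_le_truncated_potential: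
  fixes v G :: "real ^ 2 \<Rightarrow> real"
  assumes v: "C_k 1 v" and r: "0 < r"
    and G: "\<And>y. y \<in> ball 0 r \<Longrightarrow> norm (gradient v (x + y)) + \<bar>v (x + y)\<bar> / r \<le> G (x + y)"
  shows "ennreal (pi * \<bar>v x\<bar>) \<le> (\<integral>\<^sup>+y. ennreal (G (x + y) / norm y) * indicator (ball 0 r) y \<partial>lborel)"
proof -
  have [measurable]: "v \<in> borel_measurable borel" "gradient v \<in> borel_measurable borel"
    by (intro borel_measurable_continuous_onI C_k_1_continuous_on C_k_1_continuous_on_gradient v)+
  have "ennreal (pi * \<bar>v x\<bar>) = ennreal (1 / r\<^sup>2) * ennreal (pi * r\<^sup>2 * \<bar>v x\<bar>)"
    using r by (simp flip: ennreal_mult)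
  also have "\<dots> \<le> ennreal (1 / r\<^sup>2) * ((\<integral>\<^sup>+y. ennreal \<bar>v (x + y)\<bar> * indicator (ball 0 r) y \<partial>lborel)
      + (\<integral>\<^sup>+y. ennreal (r\<^sup>2 / 2 * norm (gradient v (x + y)) / norm y) * indicator (ball 0 r) y \<partial>lborel))"
    by (intro mult_left_mono abs_le_ball_average v r) simp
  also have "\<dots> = (\<integral>\<^sup>+y. ennreal (1 / r\<^sup>2) * (ennreal \<bar>v (x + y)\<bar> * indicator (ball 0 r) y
      + ennreal (r\<^sup>2 / 2 * norm (gradient v (x + y)) / norm y) * indicator (ball 0 r) y) \<partial>lborel)"
    by (subst nn_integral_cmult, measurable, subst nn_integral_add) auto
  also have "\<dots> \<le> (\<integral>\<^sup>+y. ennreal (G (x + y) / norm y) * indicator (ball 0 r) y \<partial>lborel)"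
  proof (rule nn_integral_mono_AE)
    show "AE y in lborel. ennreal (1 / r\<^sup>2) * (ennreal \<bar>v (x + y)\<bar> * indicator (ball 0 r) y
        + ennreal (r\<^sup>2 / 2 * norm (gradient v (x + y)) / norm y) * indicator (ball 0 r) y)
      \<le> ennreal (G (x + y) / norm y) * indicator (ball 0 r) y"
      using AE_lborel_singleton[of "0 :: real ^ 2"]
    proof eventually_elim
      fix y :: "real ^ 2" assume "y \<noteq> 0"
      show "ennreal (1 / r\<^sup>2) * (ennreal \<bar>v (x + y)\<bar> * indicator (ball 0 r) y
          + ennreal (r\<^sup>2 / 2 * norm (gradient v (x + y)) / norm y) * indicator (ball 0 r) y)
        \<le> ennreal (G (x + y) / norm y) * indicator (ball 0 r) y"
      proof (cases "y \<in> ball 0 r")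
        case True
        then have y: "0 < norm y" "norm y \<le> r" using \<open>y \<noteq> 0\<close> by auto
        have "\<bar>v (x + y)\<bar> / r / r \<le> \<bar>v (x + y)\<bar> / r / norm y"
          by (rule divide_left_mono[OF y(2) divide_nonneg_pos[OF abs_ge_zero r] mult_pos_pos[OF r y(1)]])
        then have 1: "\<bar>v (x + y)\<bar> / r\<^sup>2 \<le> \<bar>v (x + y)\<bar> / r / norm y"
          by (simp add: power2_eq_square)
        have 2: "norm (gradient v (x + y)) / 2 / norm y \<le> norm (gradient v (x + y)) / norm y"
          using y by (intro divide_right_mono) auto
        have "1 / r\<^sup>2 * (\<bar>v (x + y)\<bar> + r\<^sup>2 / 2 * norm (gradient v (x + y)) / norm y)
            = \<bar>v (x + y)\<bar> / r\<^sup>2 + norm (gradient v (x + y)) / 2 / norm y"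
          using r by (simp add: distrib_left)
        also have "\<dots> \<le> \<bar>v (x + y)\<bar> / r / norm y + norm (gradient v (x + y)) / norm y"
          by (intro add_mono 1 2)
        also have "\<dots> = (norm (gradient v (x + y)) + \<bar>v (x + y)\<bar> / r) / norm y"
          by (simp add: add_divide_distrib)
        also have "\<dots> \<le> G (x + y) / norm y"
          using G[OF True] by (rule divide_right_mono) simp
        finally show ?thesis
          using True r by (simp add: ennreal_leI flip: ennreal_plus ennreal_mult)
      qed simp
    qed
  qed
  finally show ?thesis .
qed

text \<open>The exponents are chosen so that the \<open>k\<close>-th power, which Jensen's inequality moves onto the
  kernel \<open>|y| powr (-1/k)\<close>, produces \<open>1 / |y|\<close> for every \<open>k\<close>, while the complementary kernel
  \<open>|y| powr (1/k - 2)\<close> has integral of order \<open>k\<close>. This linear growth in \<open>k\<close> is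
  what makes the square of the function exponentially integrable.\<close>

lemma truncated_potential_power_le:
  fixes g :: "real ^ 2 \<Rightarrow> real"
  assumes [measurable]: "g \<in> borel_measurable borel" and g: "\<And>y. 0 \<le> g y"
    and r: "0 < r" and k: "k = Suc n"
  shows "(\<integral>\<^sup>+y. ennreal (g y / norm y) * indicator (ball 0 r) y \<partial>lborel) ^ (2 * k)
    \<le> ennreal ((2 * pi * k) ^ k * r) * (\<integral>\<^sup>+y. ennreal ((g y)\<^sup>2) \<partial>lborel) ^ n
      * (\<integral>\<^sup>+y. ennreal ((g y)\<^sup>2 / norm y) * indicator (ball 0 r) y \<partial>lborel)"
proof -
  have k0: "0 < real k" by (simp add: k)
  define a where "a = 1 / real k"
  have a: "0 < a" "a \<le> 2" by (simp_all add: a_def k field_simps)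
  define B where "B = ball (0 :: real ^ 2) r"
  have [measurable]: "B \<in> sets borel" by (simp add: B_def)
  let ?p = "\<lambda>y. ennreal ((g y)\<^sup>2) * indicator B y"
  let ?f = "\<lambda>y :: real ^ 2. ennreal (norm y powr - a)"
  have "(\<integral>\<^sup>+y. ennreal (g y / norm y) * indicator B y \<partial>lborel)\<^sup>2
      = (\<integral>\<^sup>+y. (ennreal (norm y powr ((a - 2) / 2)) * indicator B y)
          * (ennreal (g y * norm y powr (- a / 2)) * indicator B y) \<partial>lborel)\<^sup>2"
  proof (intro arg_cong[where f="\<lambda>x. x\<^sup>2"] nn_integral_cong)
    fix y :: "real ^ 2"
    have "norm y powr ((a - 2) / 2) * norm y powr (- a / 2) = 1 / norm y"
    proof -
      have "(a - 2) / 2 + - a / 2 = -1" by (simp add: field_simps)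
      then have "norm y powr ((a - 2) / 2) * norm y powr (- a / 2) = norm y powr -1"
        by (metis powr_add)
      then show ?thesis by (simp add: powr_minus_divide)
    qed
    then have "g y / norm y = norm y powr ((a - 2) / 2) * (g y * norm y powr (- a / 2))"
      by (metis mult.left_commute times_divide_eq_right mult.right_neutral)
    then show "ennreal (g y / norm y) * indicator B y
        = (ennreal (norm y powr ((a - 2) / 2)) * indicator B y)
          * (ennreal (g y * norm y powr (- a / 2)) * indicator B y)"
      using g[of y] by (simp add: ennreal_mult indicator_def)
  qed
  also have "\<dots> \<le> (\<integral>\<^sup>+y. (ennreal (norm (y :: real ^ 2) powr ((a - 2) / 2)) * indicator B y)\<^sup>2 \<partial>lborel)
      * (\<integral>\<^sup>+y. (ennreal (g y * norm y powr (- a / 2)) * indicator B y)\<^sup>2 \<partial>lborel)"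
    by (rule Cauchy_Schwarz_nn_integral) measurable
  also have "(\<integral>\<^sup>+y. (ennreal (norm (y :: real ^ 2) powr ((a - 2) / 2)) * indicator B y)\<^sup>2 \<partial>lborel)
      = (\<integral>\<^sup>+y. ennreal (norm (y :: real ^ 2) powr (a - 2)) * indicator B y \<partial>lborel)"
    by (intro nn_integral_cong) (simp add: power2_eq_square indicator_def flip: ennreal_mult powr_add)
  also have "(\<integral>\<^sup>+y. (ennreal (g y * norm y powr (- a / 2)) * indicator B y)\<^sup>2 \<partial>lborel)
      = (\<integral>\<^sup>+y. ?p y * ?f y \<partial>lborel)"
  proof (rule nn_integral_cong)
    fix y :: "real ^ 2"
    have "(norm y powr (- a / 2))\<^sup>2 = norm y powr - a"
      by (simp add: power2_eq_square flip: powr_add)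
    then have "(g y * norm y powr (- a / 2))\<^sup>2 = (g y)\<^sup>2 * norm y powr - a"
      by (simp add: power_mult_distrib)
    then show "(ennreal (g y * norm y powr (- a / 2)) * indicator B y)\<^sup>2 = ?p y * ?f y"
      using g[of y] by (simp add: indicator_def ennreal_power flip: ennreal_mult)
  qed
  also have "(\<integral>\<^sup>+y. ennreal (norm (y :: real ^ 2) powr (a - 2)) * indicator B y \<partial>lborel)
      \<le> ennreal (2 * pi * r powr a / a)"
    unfolding B_def by (rule nn_integral_ball_norm_powr[OF a r])
  finally have CS: "(\<integral>\<^sup>+y. ennreal (g y / norm y) * indicator B y \<partial>lborel)\<^sup>2
      \<le> ennreal (2 * pi * r powr a / a) * (\<integral>\<^sup>+y. ?p y * ?f y \<partial>lborel)"
    by (simp add: mult_right_mono)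
  have "(\<integral>\<^sup>+y. ?p y * ?f y \<partial>lborel) ^ k \<le> (\<integral>\<^sup>+y. ?p y \<partial>lborel) ^ n * (\<integral>\<^sup>+y. ?p y * ?f y ^ k \<partial>lborel)"
    unfolding k by (rule nn_integral_power_mean) measurable
  also have "\<dots> \<le> (\<integral>\<^sup>+y. ennreal ((g y)\<^sup>2) \<partial>lborel) ^ n * (\<integral>\<^sup>+y. ?p y * ?f y ^ k \<partial>lborel)"
    by (intro mult_right_mono power_mono nn_integral_mono) (auto simp: indicator_def)
  also have "(\<integral>\<^sup>+y. ?p y * ?f y ^ k \<partial>lborel)
      = (\<integral>\<^sup>+y. ennreal ((g y)\<^sup>2 / norm y) * indicator B y \<partial>lborel)"
  proof (rule nn_integral_cong)
    fix y :: "real ^ 2"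
    have "(norm y powr - a) ^ k = 1 / norm y"
    proof (cases "y = 0")
      case False
      then have "(norm y powr - a) ^ k = norm y powr (- a * real k)"
        by (simp add: powr_powr flip: powr_realpow)
      also have "- a * real k = -1" using k0 by (simp add: a_def)
      finally show ?thesis by (simp add: powr_minus_divide)
    qed (simp add: k)
    then show "?p y * ?f y ^ k = ennreal ((g y)\<^sup>2 / norm y) * indicator B y"
      by (simp add: indicator_def ennreal_power flip: ennreal_mult)
  qed
  finally have J: "(\<integral>\<^sup>+y. ?p y * ?f y \<partial>lborel) ^ k
      \<le> (\<integral>\<^sup>+y. ennreal ((g y)\<^sup>2) \<partial>lborel) ^ n * (\<integral>\<^sup>+y. ennreal ((g y)\<^sup>2 / norm y) * indicator B y \<partial>lborel)" .
  have const: "(2 * pi * r powr a / a) ^ k = (2 * pi * k) ^ k * r"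
  proof -
    have "(r powr a) ^ k = r powr (a * real k)"
      using r by (simp add: powr_powr flip: powr_realpow)
    also have "\<dots> = r" using k0 r by (simp add: a_def)
    finally have "(r powr a) ^ k = r" .
    moreover have "2 * pi * r powr a / a = (2 * pi * k) * r powr a" by (simp add: a_def)
    ultimately show ?thesis by (simp only: power_mult_distrib)
  qed
  have "(\<integral>\<^sup>+y. ennreal (g y / norm y) * indicator B y \<partial>lborel) ^ (2 * k)
      \<le> (ennreal (2 * pi * r powr a / a) * (\<integral>\<^sup>+y. ?p y * ?f y \<partial>lborel)) ^ k"
    unfolding power_mult by (intro power_mono CS) simp
  also have "\<dots> = ennreal ((2 * pi * k) ^ k * r) * (\<integral>\<^sup>+y. ?p y * ?f y \<partial>lborel) ^ k"
  proof -
    have "ennreal (2 * pi * r powr a / a) ^ k = ennreal ((2 * pi * k) ^ k * r)"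
      using a by (simp add: ennreal_power const)
    then show ?thesis
      by (simp only: power_mult_distrib[of "ennreal (2 * pi * r powr a / a)"])
  qed
  also have "\<dots> \<le> ennreal ((2 * pi * k) ^ k * r) * ((\<integral>\<^sup>+y. ennreal ((g y)\<^sup>2) \<partial>lborel) ^ n
      * (\<integral>\<^sup>+y. ennreal ((g y)\<^sup>2 / norm y) * indicator B y \<partial>lborel))"
    by (intro mult_left_mono J) simp
  finally show ?thesis by (simp add: mult.assoc B_def)
qed

section \<open>Exponential integrability with weight \<open>\<delta>\<^sup>-\<^sup>2\<close>\<close>

lemma norm_minus_add_eq_dist: "norm (- x + y) = dist x y"
  by (metis dist_commute dist_norm uminus_add_conv_diff)

text \<open>If \<open>|x - y| < \<delta> x / 2\<close> then \<open>|x - y| < \<delta> y\<close> and \<open>\<delta> y \<le> 3/2 \<delta> x\<close>. So after exchanging the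
  integrals, the inner integral over \<open>x\<close> is at most \<open>3 / (4 \<delta> y)\<close> times that of \<open>1 / |x - y|\<close> over
  the ball of radius \<open>\<delta> y\<close>, and the powers of \<open>\<delta> y\<close> cancel.\<close>

lemma nn_integral_truncated_potential_le:
  fixes F \<delta> :: "real ^ 2 \<Rightarrow> real"
  assumes [measurable]: "F \<in> borel_measurable borel" "\<delta> \<in> borel_measurable borel" "\<Omega> \<in> sets borel"
    and F: "\<And>y. 0 \<le> F y" "\<And>y. y \<notin> \<Omega> \<Longrightarrow> F y = 0"
    and pos: "\<And>x. x \<in> \<Omega> \<Longrightarrow> 0 < \<delta> x"
    and lip: "\<And>x y. \<bar>\<delta> x - \<delta> y\<bar> \<le> dist x y"
  shows "(\<integral>\<^sup>+x. ennreal (1 / (2 * \<delta> x))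
      * (\<integral>\<^sup>+y. ennreal (F (x + y) / norm y) * indicator (ball 0 (\<delta> x / 2)) y \<partial>lborel)
      * indicator \<Omega> x \<partial>lborel) \<le> ennreal (3 * pi / 2) * (\<integral>\<^sup>+y. ennreal (F y) \<partial>lborel)"
proof -
  define K where "K x y = (if x \<in> \<Omega> \<and> dist x y < \<delta> x / 2
    then ennreal (1 / (2 * \<delta> x) * (F y / dist x y)) else 0)" for x y
  have "(\<integral>\<^sup>+x. ennreal (1 / (2 * \<delta> x))
      * (\<integral>\<^sup>+y. ennreal (F (x + y) / norm y) * indicator (ball 0 (\<delta> x / 2)) y \<partial>lborel)
      * indicator \<Omega> x \<partial>lborel) = (\<integral>\<^sup>+x. (\<integral>\<^sup>+y. K x y \<partial>lborel) \<partial>lborel)"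
  proof (rule nn_integral_cong)
    fix x :: "real ^ 2"
    let ?H = "\<lambda>y. ennreal (F (x + y) / norm y) * indicator (ball 0 (\<delta> x / 2)) y"
    show "ennreal (1 / (2 * \<delta> x)) * (\<integral>\<^sup>+y. ?H y \<partial>lborel) * indicator \<Omega> x = (\<integral>\<^sup>+y. K x y \<partial>lborel)"
    proof (cases "x \<in> \<Omega>")
      case True
      have "?H \<in> borel_measurable borel" by measurable
      from nn_integral_affine[OF this, of 1 "- x"]
      have shift: "(\<integral>\<^sup>+y. ?H y \<partial>lborel) = (\<integral>\<^sup>+y. ?H (- x + y) \<partial>lborel)" by simp
      have "ennreal (1 / (2 * \<delta> x)) * (\<integral>\<^sup>+y. ?H y \<partial>lborel) = (\<integral>\<^sup>+y. ennreal (1 / (2 * \<delta> x)) * ?H (- x + y) \<partial>lborel)"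
        unfolding shift by (rule nn_integral_cmult[symmetric]) measurable
      also have "\<dots> = (\<integral>\<^sup>+y. K x y \<partial>lborel)"
      proof (rule nn_integral_cong)
        fix y :: "real ^ 2"
        have "norm (- x + y) = dist x y" by (rule norm_minus_add_eq_dist)
        then show "ennreal (1 / (2 * \<delta> x)) * ?H (- x + y) = K x y"
          using True pos[OF True] F(1) by (simp add: K_def indicator_def flip: ennreal_mult)
      qed
      finally show ?thesis using True by simp
    qed (simp add: K_def)
  qed
  also have "\<dots> = (\<integral>\<^sup>+y. (\<integral>\<^sup>+x. K x y \<partial>lborel) \<partial>lborel)"
    by (rule Tonelli_lborel) (unfold K_def, measurable)
  also have "\<dots> \<le> (\<integral>\<^sup>+y. ennreal (3 * pi / 2) * ennreal (F y) \<partial>lborel)"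
  proof (rule nn_integral_mono)
    fix y :: "real ^ 2"
    show "(\<integral>\<^sup>+x. K x y \<partial>lborel) \<le> ennreal (3 * pi / 2) * ennreal (F y)"
    proof (cases "y \<in> \<Omega>")
      case True
      have \<delta>y: "0 < \<delta> y" by (rule pos[OF True])
      define R :: "real ^ 2 \<Rightarrow> ennreal" where "R z = ennreal (norm z powr (1 - 2)) * indicator (ball 0 (\<delta> y)) z" for z
      have [measurable]: "R \<in> borel_measurable borel"
        unfolding R_def by measurable
      have "K x y \<le> ennreal (3 / (4 * \<delta> y) * F y) * R (- y + x)" for x
      proof (cases "x \<in> \<Omega> \<and> dist x y < \<delta> x / 2")
        case True
        then have "0 < \<delta> x" using pos by blast
        from True lip[of x y] have "\<delta> y \<le> 3 / 2 * \<delta> x" "dist x y < \<delta> y" by linarith+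
        have "1 / (2 * \<delta> x) \<le> 3 / (4 * \<delta> y)"
          using \<open>\<delta> y \<le> 3 / 2 * \<delta> x\<close> \<open>0 < \<delta> x\<close> \<delta>y by (simp add: field_simps)
        then have "1 / (2 * \<delta> x) * (F y / dist x y) \<le> 3 / (4 * \<delta> y) * (F y / dist x y)"
          by (rule mult_right_mono) (simp add: F(1))
        also have "\<dots> = 3 / (4 * \<delta> y) * F y * norm (- y + x) powr (1 - 2)"
          by (simp add: dist_norm powr_minus_divide)
        finally have "K x y \<le> ennreal (3 / (4 * \<delta> y) * F y * norm (- y + x) powr (1 - 2))"
          using True by (simp add: K_def ennreal_leI)
        also have "\<dots> = ennreal (3 / (4 * \<delta> y) * F y) * R (- y + x)"
          using \<open>dist x y < \<delta> y\<close> \<delta>y F(1)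
          by (simp add: R_def dist_norm indicator_def norm_minus_commute[of y x] flip: ennreal_mult)
        finally show ?thesis .
      qed (auto simp: K_def)
      then have "(\<integral>\<^sup>+x. K x y \<partial>lborel) \<le> (\<integral>\<^sup>+x. ennreal (3 / (4 * \<delta> y) * F y) * R (- y + x) \<partial>lborel)"
        by (intro nn_integral_mono)
      also have "\<dots> = ennreal (3 / (4 * \<delta> y) * F y) * (\<integral>\<^sup>+x. R (- y + x) \<partial>lborel)"
        by (rule nn_integral_cmult) measurable
      also have "(\<integral>\<^sup>+x. R (- y + x) \<partial>lborel) = (\<integral>\<^sup>+x. R x \<partial>lborel)"
        using nn_integral_affine[of R 1 "- y"] by simp
      also have "\<dots> \<le> ennreal (2 * pi * \<delta> y powr 1 / 1)"
        unfolding R_def by (rule nn_integral_ball_norm_powr) (use \<delta>y in auto)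
      also have "ennreal (3 / (4 * \<delta> y) * F y) * ennreal (2 * pi * \<delta> y powr 1 / 1)
          = ennreal (3 * pi / 2) * ennreal (F y)"
        using \<delta>y F(1) by (simp add: field_simps flip: ennreal_mult)
      finally show ?thesis by (simp add: mult_left_mono)
    next
      case False
      then have "K x y = 0" for x using F(2) by (simp add: K_def)
      then show ?thesis by simp
    qed
  qed
  also have "\<dots> = ennreal (3 * pi / 2) * (\<integral>\<^sup>+y. ennreal (F y) \<partial>lborel)"
    by (rule nn_integral_cmult) measurable
  finally show ?thesis .
qed

text \<open>The factor 3 in \<open>G\<close> comes from \<open>\<delta> \<le> 3 r\<close> on the ball of radius \<open>r = \<delta> x / 2\<close> about \<open>x\<close>. The power
  bound leaves a factor \<open>r / (\<delta> x)\<^sup>2 = 1 / (2 \<delta> x)\<close>, the weight of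
  \<open>nn_integral_truncated_potential_le\<close>.\<close>

lemma weighted_even_power_integral_le:
  fixes v \<delta> :: "real ^ 2 \<Rightarrow> real"
  assumes v: "C_k 1 v" and [measurable]: "\<Omega> \<in> sets borel"
    and supp: "\<And>x. x \<notin> \<Omega> \<Longrightarrow> v x = 0" "\<And>x. x \<notin> \<Omega> \<Longrightarrow> gradient v x = 0"
    and pos: "\<And>x. x \<in> \<Omega> \<Longrightarrow> 0 < \<delta> x"
    and lip: "\<And>x y. \<bar>\<delta> x - \<delta> y\<bar> \<le> dist x y"
    and \<delta>[measurable]: "\<delta> \<in> borel_measurable borel"
    and G: "\<And>y. G y = norm (gradient v y) + 3 * \<bar>v y\<bar> / \<delta> y"
    and k: "k = Suc n"
  shows "(\<integral>\<^sup>+x. ennreal (v x ^ (2 * k) / (\<delta> x)\<^sup>2) * indicator \<Omega> x \<partial>lborel)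
    \<le> ennreal (5 * real k ^ k) * (\<integral>\<^sup>+y. ennreal ((G y)\<^sup>2) \<partial>lborel) ^ k"
proof -
  have [measurable]: "v \<in> borel_measurable borel" "gradient v \<in> borel_measurable borel"
    by (intro borel_measurable_continuous_onI C_k_1_continuous_on C_k_1_continuous_on_gradient v)+
  have Gm[measurable]: "G \<in> borel_measurable borel"
    unfolding G[abs_def] by measurable
  have G0: "0 \<le> G y" for y
    using supp(1)[of y] pos[of y] by (cases "y \<in> \<Omega>") (simp_all add: G)
  have G_out: "G y = 0" if "y \<notin> \<Omega>" for y
    using supp that by (simp add: G)
  define Q where "Q = (\<integral>\<^sup>+y. ennreal ((G y)\<^sup>2) \<partial>lborel)"
  define P where "P x = (\<integral>\<^sup>+y. ennreal ((G (x + y))\<^sup>2 / norm y) * indicator (ball 0 (\<delta> x / 2)) y \<partial>lborel)" for x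
  have P_meas: "(\<lambda>x. ennreal (1 / (2 * \<delta> x)) * P x * indicator \<Omega> x) \<in> borel_measurable lborel"
  proof -
    have P_eq: "P x = (\<integral>\<^sup>+y. (if norm y < \<delta> x / 2 then ennreal ((G (x + y))\<^sup>2 / norm y) else 0) \<partial>lborel)" for x
      unfolding P_def by (intro nn_integral_cong) (simp add: indicator_def)
    have "(\<lambda>x. \<integral>\<^sup>+y. (if norm y < \<delta> x / 2 then ennreal ((G (x + y))\<^sup>2 / norm y) else 0) \<partial>lborel)
        \<in> borel_measurable lborel"
      by measurable
    then have "P \<in> borel_measurable lborel"
      unfolding P_eq[abs_def, symmetric] .
    then show ?thesis by measurable
  qed
  have pointwise: "ennreal (v x ^ (2 * k) / (\<delta> x)\<^sup>2) * indicator \<Omega> x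
      \<le> ennreal (real k ^ k) * Q ^ n * (ennreal (1 / (2 * \<delta> x)) * P x * indicator \<Omega> x)" for x
  proof (cases "x \<in> \<Omega>")
    case True
    define r where "r = \<delta> x / 2"
    have r: "0 < r" "\<delta> x = 2 * r" using pos[OF True] by (simp_all add: r_def)
    have le_G: "norm (gradient v (x + y)) + \<bar>v (x + y)\<bar> / r \<le> G (x + y)" if "y \<in> ball 0 r" for y
    proof (cases "x + y \<in> \<Omega>")
      case True
      have "\<delta> (x + y) \<le> 3 * r"
        using lip[of "x + y" x] that r by (simp add: dist_norm)
      then have "\<bar>v (x + y)\<bar> * \<delta> (x + y) \<le> \<bar>v (x + y)\<bar> * (3 * r)"
        by (rule mult_left_mono) simp
      then have "\<bar>v (x + y)\<bar> / r \<le> 3 * \<bar>v (x + y)\<bar> / \<delta> (x + y)"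
        using r(1) pos[OF True] by (simp add: field_simps)
      then show ?thesis by (simp add: G)
    qed (simp add: supp G)
    have "ennreal ((pi * \<bar>v x\<bar>) ^ (2 * k)) = ennreal (pi * \<bar>v x\<bar>) ^ (2 * k)"
      by (simp add: ennreal_power)
    also have "\<dots> \<le> (\<integral>\<^sup>+y. ennreal (G (x + y) / norm y) * indicator (ball 0 r) y \<partial>lborel) ^ (2 * k)"
      by (intro power_mono abs_le_truncated_potential v r le_G) auto
    also have "\<dots> \<le> ennreal ((2 * pi * k) ^ k * r) * (\<integral>\<^sup>+y. ennreal ((G (x + y))\<^sup>2) \<partial>lborel) ^ n
        * (\<integral>\<^sup>+y. ennreal ((G (x + y))\<^sup>2 / norm y) * indicator (ball 0 r) y \<partial>lborel)"
      by (rule truncated_potential_power_le[OF _ G0 r(1) k]) measurable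
    also have "(\<integral>\<^sup>+y. ennreal ((G (x + y))\<^sup>2) \<partial>lborel) = Q"
      using nn_integral_affine[of "\<lambda>y. ennreal ((G y)\<^sup>2)" 1 x] by (simp add: Q_def)
    finally have 1: "ennreal ((pi * \<bar>v x\<bar>) ^ (2 * k)) \<le> ennreal ((2 * pi * k) ^ k * r) * Q ^ n * P x"
      by (simp add: P_def r_def)
    define c where "c = 1 / (pi ^ (2 * k) * (\<delta> x)\<^sup>2)"
    have c: "0 \<le> c" by (simp add: c_def)
    have "v x ^ (2 * k) = \<bar>v x\<bar> ^ (2 * k)" by (simp add: power_even_abs)
    then have "c * (pi * \<bar>v x\<bar>) ^ (2 * k) = v x ^ (2 * k) / (\<delta> x)\<^sup>2"
      by (simp add: c_def power_mult_distrib)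
    then have "ennreal (v x ^ (2 * k) / (\<delta> x)\<^sup>2) = ennreal c * ennreal ((pi * \<bar>v x\<bar>) ^ (2 * k))"
      using c by (simp flip: ennreal_mult)
    also have "\<dots> \<le> ennreal c * (ennreal ((2 * pi * k) ^ k * r) * Q ^ n * P x)"
      by (intro mult_left_mono 1) simp
    also have "\<dots> = ennreal (c * ((2 * pi * k) ^ k * r)) * (Q ^ n * P x)"
      using c r by (simp add: ennreal_mult mult.assoc)
    also have "\<dots> \<le> ennreal (real k ^ k * (1 / (2 * \<delta> x))) * (Q ^ n * P x)"
    proof (intro mult_right_mono ennreal_leI)
      have "(2 * pi * real k) ^ k \<le> (pi * pi * real k) ^ k"
        by (intro power_mono mult_right_mono) (use pi_gt3 in auto)
      also have "\<dots> = pi ^ (2 * k) * real k ^ k"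
        by (simp add: power_mult_distrib mult_2 power_add)
      finally have "(2 * pi * real k) ^ k / pi ^ (2 * k) \<le> real k ^ k"
        by (simp add: divide_le_eq mult.commute)
      then have "(2 * pi * real k) ^ k / pi ^ (2 * k) * (r / (\<delta> x)\<^sup>2) \<le> real k ^ k * (r / (\<delta> x)\<^sup>2)"
        by (rule mult_right_mono) (use r in simp)
      moreover have "r / (\<delta> x)\<^sup>2 = 1 / (2 * \<delta> x)"
        using r by (simp add: power2_eq_square)
      moreover have "c * ((2 * pi * real k) ^ k * r) = (2 * pi * real k) ^ k / pi ^ (2 * k) * (r / (\<delta> x)\<^sup>2)"
        by (simp add: c_def)
      ultimately show "c * ((2 * pi * real k) ^ k * r) \<le> real k ^ k * (1 / (2 * \<delta> x))"
        by (simp only:)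
    qed simp
    also have "\<dots> = ennreal (real k ^ k) * Q ^ n * (ennreal (1 / (2 * \<delta> x)) * P x)"
    proof -
      have "ennreal (real k ^ k * (1 / (2 * \<delta> x))) = ennreal (real k ^ k) * ennreal (1 / (2 * \<delta> x))"
        by (rule ennreal_mult) (use r in auto)
      then show ?thesis by (simp only: mult_ac)
    qed
    finally show ?thesis using True by simp
  qed simp
  have "(\<integral>\<^sup>+x. ennreal (v x ^ (2 * k) / (\<delta> x)\<^sup>2) * indicator \<Omega> x \<partial>lborel)
      \<le> (\<integral>\<^sup>+x. ennreal (real k ^ k) * Q ^ n * (ennreal (1 / (2 * \<delta> x)) * P x * indicator \<Omega> x) \<partial>lborel)"
    by (intro nn_integral_mono pointwise)
  also have "\<dots> = ennreal (real k ^ k) * Q ^ n * (\<integral>\<^sup>+x. ennreal (1 / (2 * \<delta> x)) * P x * indicator \<Omega> x \<partial>lborel)"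
    by (rule nn_integral_cmult[OF P_meas])
  also have "\<dots> \<le> ennreal (real k ^ k) * Q ^ n * (ennreal (3 * pi / 2) * Q)"
    unfolding P_def Q_def
    by (intro mult_left_mono nn_integral_truncated_potential_le) (use G_out pos lip in auto)
  also have "\<dots> \<le> ennreal (real k ^ k) * Q ^ n * (ennreal 5 * Q)"
    by (intro mult_left_mono mult_right_mono ennreal_leI) (use pi_less_4 pi_approx in auto)
  also have "\<dots> = ennreal (5 * real k ^ k) * Q ^ k"
    by (simp add: k ennreal_mult mult_ac)
  finally show ?thesis by (simp add: Q_def)
qed

lemma self_power_le: "real k ^ k \<le> 3 ^ k * fact k"
proof -
  have "(\<Sum>n\<in>{k}. real k ^ n /\<^sub>R fact n) \<le> (\<Sum>n. real k ^ n /\<^sub>R fact n)"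
    by (rule sum_le_suminf[OF summable_exp_generic]) auto
  then have "real k ^ k / fact k \<le> exp (real k)"
    by (simp add: exp_def divide_inverse mult.commute)
  also have "\<dots> = exp 1 ^ k" by (simp flip: exp_of_nat_mult)
  also have "\<dots> \<le> 3 ^ k" by (intro power_mono exp_le) simp
  finally show ?thesis by (simp add: divide_le_eq)
qed

text \<open>Expand the exponential and integrate term by term. By \<open>k\<^sup>k \<le> 3\<^sup>k k!\<close> the \<open>k\<close>-th term is at most
  \<open>5 (6 / 12)\<^sup>k\<close>.\<close>

lemma weighted_exp_integral_le:
  fixes v \<delta> :: "real ^ 2 \<Rightarrow> real"
  assumes v: "C_k 1 v" and [measurable]: "\<Omega> \<in> sets borel"
    and supp: "\<And>x. x \<notin> \<Omega> \<Longrightarrow> v x = 0" "\<And>x. x \<notin> \<Omega> \<Longrightarrow> gradient v x = 0"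
    and pos: "\<And>x. x \<in> \<Omega> \<Longrightarrow> 0 < \<delta> x"
    and lip: "\<And>x y. \<bar>\<delta> x - \<delta> y\<bar> \<le> dist x y"
    and \<delta>[measurable]: "\<delta> \<in> borel_measurable borel"
    and small: "(\<integral>\<^sup>+y. ennreal ((norm (gradient v y) + 3 * \<bar>v y\<bar> / \<delta> y)\<^sup>2) \<partial>lborel) \<le> ennreal (1 / 12)"
  shows "(\<integral>\<^sup>+x. ennreal ((exp (2 * (v x)\<^sup>2) - 1) / (\<delta> x)\<^sup>2) * indicator \<Omega> x \<partial>lborel) \<le> 5"
proof -
  have [measurable]: "v \<in> borel_measurable borel"
    by (intro borel_measurable_continuous_onI C_k_1_continuous_on v)
  define G where "G y = norm (gradient v y) + 3 * \<bar>v y\<bar> / \<delta> y" for y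
  define e where "e n x = ennreal (2 ^ Suc n / fact (Suc n))
    * (ennreal (v x ^ (2 * Suc n) / (\<delta> x)\<^sup>2) * indicator \<Omega> x)" for n x
  have series: "ennreal ((exp (2 * (v x)\<^sup>2) - 1) / (\<delta> x)\<^sup>2) * indicator \<Omega> x = (\<Sum>n. e n x)" for x
  proof (cases "x \<in> \<Omega>")
    case True
    have "(\<lambda>n. (2 * (v x)\<^sup>2) ^ n /\<^sub>R fact n) sums (exp (2 * (v x)\<^sup>2) - 1 + (2 * (v x)\<^sup>2) ^ 0 /\<^sub>R fact 0)"
      using exp_converges[of "2 * (v x)\<^sup>2"] by simp
    then have "(\<lambda>n. (2 * (v x)\<^sup>2) ^ Suc n /\<^sub>R fact (Suc n)) sums (exp (2 * (v x)\<^sup>2) - 1)"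
      by (rule iffD2[OF sums_Suc_iff[of "\<lambda>n. (2 * (v x)\<^sup>2) ^ n /\<^sub>R fact n"]])
    then have "(\<lambda>n. (2 * (v x)\<^sup>2) ^ Suc n /\<^sub>R fact (Suc n) / (\<delta> x)\<^sup>2) sums ((exp (2 * (v x)\<^sup>2) - 1) / (\<delta> x)\<^sup>2)"
      by (rule sums_divide)
    moreover have "(2 * (v x)\<^sup>2) ^ Suc n /\<^sub>R fact (Suc n) / (\<delta> x)\<^sup>2
        = 2 ^ Suc n / fact (Suc n) * (v x ^ (2 * Suc n) / (\<delta> x)\<^sup>2)" for n
      unfolding power_mult power_mult_distrib by (simp add: divide_inverse mult_ac del: power_Suc fact_Suc)
    ultimately have s: "(\<lambda>n. 2 ^ Suc n / fact (Suc n) * (v x ^ (2 * Suc n) / (\<delta> x)\<^sup>2)) sums ((exp (2 * (v x)\<^sup>2) - 1) / (\<delta> x)\<^sup>2)"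
      by (simp only:)
    have nn: "0 \<le> v x ^ (2 * Suc n) / (\<delta> x)\<^sup>2" for n
      by (intro divide_nonneg_nonneg zero_le_even_power) auto
    have "(\<Sum>n. ennreal (2 ^ Suc n / fact (Suc n) * (v x ^ (2 * Suc n) / (\<delta> x)\<^sup>2)))
        = ennreal (\<Sum>n. 2 ^ Suc n / fact (Suc n) * (v x ^ (2 * Suc n) / (\<delta> x)\<^sup>2))"
    proof (rule suminf_ennreal2)
      show "0 \<le> 2 ^ Suc n / fact (Suc n) * (v x ^ (2 * Suc n) / (\<delta> x)\<^sup>2)" for n
        by (intro mult_nonneg_nonneg nn) simp
    qed (rule sums_summable[OF s])
    also have "\<dots> = ennreal ((exp (2 * (v x)\<^sup>2) - 1) / (\<delta> x)\<^sup>2)"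
      using sums_unique[OF s] by (simp only:)
    also have "(\<lambda>n. ennreal (2 ^ Suc n / fact (Suc n) * (v x ^ (2 * Suc n) / (\<delta> x)\<^sup>2))) = (\<lambda>n. e n x)"
    proof
      fix n
      have "ennreal (2 ^ Suc n / fact (Suc n) * (v x ^ (2 * Suc n) / (\<delta> x)\<^sup>2))
          = ennreal (2 ^ Suc n / fact (Suc n)) * ennreal (v x ^ (2 * Suc n) / (\<delta> x)\<^sup>2)"
        by (rule ennreal_mult') simp
      then show "ennreal (2 ^ Suc n / fact (Suc n) * (v x ^ (2 * Suc n) / (\<delta> x)\<^sup>2)) = e n x"
        using True by (simp only: e_def indicator_simps mult_1_right)
    qed
    finally show ?thesis
      using True by (simp only: indicator_simps mult_1_right)
  qed (simp add: e_def)
  have term_le: "(\<integral>\<^sup>+x. e n x \<partial>lborel) \<le> ennreal (5 * (1 / 2) ^ Suc n)" for n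
  proof -
    have "(\<integral>\<^sup>+x. e n x \<partial>lborel) = ennreal (2 ^ Suc n / fact (Suc n))
        * (\<integral>\<^sup>+x. ennreal (v x ^ (2 * Suc n) / (\<delta> x)\<^sup>2) * indicator \<Omega> x \<partial>lborel)"
      unfolding e_def by (rule nn_integral_cmult) measurable
    also have "\<dots> \<le> ennreal (2 ^ Suc n / fact (Suc n))
        * (ennreal (5 * real (Suc n) ^ Suc n) * (\<integral>\<^sup>+y. ennreal ((G y)\<^sup>2) \<partial>lborel) ^ Suc n)"
      by (intro mult_left_mono weighted_even_power_integral_le[OF v _ supp pos lip])
        (auto simp: G_def)
    also have "\<dots> \<le> ennreal (2 ^ Suc n / fact (Suc n))
        * (ennreal (5 * real (Suc n) ^ Suc n) * ennreal (1 / 12) ^ Suc n)"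
      using small by (intro mult_left_mono power_mono) (auto simp: G_def)
    also have "\<dots> = ennreal (2 ^ Suc n / fact (Suc n) * (5 * real (Suc n) ^ Suc n * (1 / 12) ^ Suc n))"
    proof -
      have p: "ennreal (1 / 12) ^ Suc n = ennreal ((1 / 12) ^ Suc n)"
        by (rule ennreal_power) simp
      have mult3: "ennreal a * (ennreal b * ennreal c) = ennreal (a * (b * c))" if "0 \<le> a" "0 \<le> b" for a b c
        using that by (simp add: ennreal_mult')
      show ?thesis unfolding p by (rule mult3) auto
    qed
    also have "\<dots> \<le> ennreal (5 * (1 / 2) ^ Suc n)"
    proof (rule ennreal_leI)
      define k where "k = Suc n"
      have "2 ^ k / fact k * (5 * real k ^ k * (1 / 12) ^ k)
          \<le> 2 ^ k / fact k * (5 * (3 ^ k * fact k) * (1 / 12) ^ k)"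
        by (intro mult_left_mono mult_right_mono self_power_le) auto
      also have "\<dots> = 5 * (2 ^ k * 3 ^ k * (1 / 12) ^ k)" by simp
      also have "2 ^ k * 3 ^ k * (1 / 12) ^ k = (1 / 2 :: real) ^ k"
        by (simp only: power_mult_distrib[symmetric]) simp
      finally show "2 ^ Suc n / fact (Suc n) * (5 * real (Suc n) ^ Suc n * (1 / 12) ^ Suc n) \<le> 5 * (1 / 2) ^ Suc n"
        by (simp only: k_def)
    qed
    finally show ?thesis .
  qed
  have "(\<integral>\<^sup>+x. ennreal ((exp (2 * (v x)\<^sup>2) - 1) / (\<delta> x)\<^sup>2) * indicator \<Omega> x \<partial>lborel)
      = (\<Sum>n. \<integral>\<^sup>+x. e n x \<partial>lborel)"
    unfolding series by (rule nn_integral_suminf) (unfold e_def, measurable)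
  also have "\<dots> \<le> (\<Sum>n. ennreal (5 * (1 / 2) ^ Suc n))"
    by (intro suminf_le term_le) auto
  also have "\<dots> = ennreal 5"
  proof -
    have "(\<lambda>n. 5 * (1 / 2 :: real) ^ Suc n) sums 5"
      using sums_mult[OF power_half_series, of 5] by (simp only: mult_1_right)
    then show ?thesis
      by (intro suminf_ennreal_eq mult_nonneg_nonneg zero_le_power) auto
  qed
  finally show ?thesis by simp
qed

section \<open>Passage to the Sobolev space\<close>

lemma norm_diff_power2_le:
  fixes a b :: "'a::real_normed_vector"
  shows "(norm (a - b))\<^sup>2 \<le> 2 * (norm a)\<^sup>2 + 2 * (norm b)\<^sup>2"
proof -
  have "(norm (a - b))\<^sup>2 \<le> (norm a + norm b)\<^sup>2"
    by (intro power_mono norm_triangle_ineq4) simp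
  also have "\<dots> \<le> 2 * (norm a)\<^sup>2 + 2 * (norm b)\<^sup>2"
    using sum_squares_bound[of "norm a" "norm b"] by (simp add: power2_sum)
  finally show ?thesis .
qed

lemma in_L2_diff:
  assumes "in_L2 \<Omega> f" "in_L2 \<Omega> g"
  shows "in_L2 \<Omega> (\<lambda>x. f x - g x)"
proof -
  have [measurable]: "f \<in> borel_measurable (lebesgue_on \<Omega>)" "g \<in> borel_measurable (lebesgue_on \<Omega>)"
    and int: "integrable (lebesgue_on \<Omega>) (\<lambda>x. (norm (f x))\<^sup>2)" "integrable (lebesgue_on \<Omega>) (\<lambda>x. (norm (g x))\<^sup>2)"
    using assms by (auto simp: in_L2_def)
  have "integrable (lebesgue_on \<Omega>) (\<lambda>x. (norm (f x - g x))\<^sup>2)"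
  proof (rule Bochner_Integration.integrable_bound)
    show "integrable (lebesgue_on \<Omega>) (\<lambda>x. 2 * (norm (f x))\<^sup>2 + 2 * (norm (g x))\<^sup>2)"
      using int by simp
    show "AE x in lebesgue_on \<Omega>. norm ((norm (f x - g x))\<^sup>2) \<le> norm (2 * (norm (f x))\<^sup>2 + 2 * (norm (g x))\<^sup>2)"
      by (rule AE_I2) (simp add: norm_diff_power2_le)
  qed measurable
  then show ?thesis by (simp add: in_L2_def)
qed

lemma L2_norm_power2: "(L2_norm \<Omega> f)\<^sup>2 = integral\<^sup>L (lebesgue_on \<Omega>) (\<lambda>x. (norm (f x))\<^sup>2)"
  unfolding L2_norm_def by (rule real_sqrt_pow2) simp

lemma nn_integral_eq_L2_norm_power2:
  "in_L2 \<Omega> f \<Longrightarrow> (\<integral>\<^sup>+x. ennreal ((norm (f x))\<^sup>2) \<partial>lebesgue_on \<Omega>) = ennreal ((L2_norm \<Omega> f)\<^sup>2)"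
  unfolding L2_norm_power2 in_L2_def by (intro nn_integral_eq_integral) auto

lemma L2_norm_diff_power2_le:
  assumes "in_L2 \<Omega> f" "in_L2 \<Omega> g" "in_L2 \<Omega> h"
  shows "(L2_norm \<Omega> (\<lambda>x. f x - g x))\<^sup>2
    \<le> 2 * (L2_norm \<Omega> (\<lambda>x. f x - h x))\<^sup>2 + 2 * (L2_norm \<Omega> (\<lambda>x. g x - h x))\<^sup>2"
proof -
  have int: "integrable (lebesgue_on \<Omega>) (\<lambda>x. (norm (f x - g x))\<^sup>2)"
      "integrable (lebesgue_on \<Omega>) (\<lambda>x. (norm (f x - h x))\<^sup>2)"
      "integrable (lebesgue_on \<Omega>) (\<lambda>x. (norm (g x - h x))\<^sup>2)"
    using assms in_L2_diff unfolding in_L2_def by blast+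
  have "(L2_norm \<Omega> (\<lambda>x. f x - g x))\<^sup>2
      \<le> integral\<^sup>L (lebesgue_on \<Omega>) (\<lambda>x. 2 * (norm (f x - h x))\<^sup>2 + 2 * (norm (g x - h x))\<^sup>2)"
    unfolding L2_norm_power2
  proof (rule integral_mono)
    show "(norm (f x - g x))\<^sup>2 \<le> 2 * (norm (f x - h x))\<^sup>2 + 2 * (norm (g x - h x))\<^sup>2" for x
      using norm_diff_power2_le[of "f x - h x" "g x - h x"] by simp
  qed (use int in auto)
  also have "\<dots> = 2 * (L2_norm \<Omega> (\<lambda>x. f x - h x))\<^sup>2 + 2 * (L2_norm \<Omega> (\<lambda>x. g x - h x))\<^sup>2"
    unfolding L2_norm_power2 using int by simp
  finally show ?thesis .
qed

lemma boundary_dist_pos: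
  assumes "open \<Omega>" "frontier \<Omega> \<noteq> {}" "x \<in> \<Omega>"
  shows "0 < boundary_dist \<Omega> x"
proof -
  have "x \<notin> frontier \<Omega>"
    using assms(1,3) by (simp add: frontier_def interior_open)
  then show ?thesis
    unfolding boundary_dist_def by (intro infdist_pos_not_in_closed frontier_closed assms(2))
qed

lemma continuous_on_boundary_dist: "continuous_on S (boundary_dist \<Omega>)"
  unfolding boundary_dist_def[abs_def] by (intro continuous_on_infdist continuous_on_id)

lemma nn_integral_lebesgue_on:
  assumes "open \<Omega>"
  shows "(\<integral>\<^sup>+x. f x \<partial>lebesgue_on \<Omega>) = (\<integral>\<^sup>+x. f x * indicator \<Omega> x \<partial>lborel)"
proof -
  have "\<Omega> \<inter> space lebesgue \<in> sets lebesgue" using assms by simp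
  then show ?thesis by (simp only: nn_integral_restrict_space nn_integral_completion)
qed

text \<open>With \<open>(a + 3 b)\<^sup>2 \<le> 2 a\<^sup>2 + 18 b\<^sup>2\<close>, Hardy's inequality absorbs the term with \<open>v / \<delta>\<close> into the Dirichlet
  energy.\<close>

lemma test_function_hardy_energy_le:
  fixes \<Omega> :: "(real ^ 'n::finite) set"
  assumes \<Omega>: "open \<Omega>" and H: "hardy_inequality \<Omega> H" and v: "test_function \<Omega> v"
  shows "(\<integral>\<^sup>+y. ennreal ((norm (gradient v y) + 3 * \<bar>v y\<bar> / boundary_dist \<Omega> y)\<^sup>2) \<partial>lborel)
    \<le> ennreal ((2 + 18 * H\<^sup>2) * (L2_norm \<Omega> (gradient v))\<^sup>2)"
proof -
  let ?q = "\<lambda>x. v x / boundary_dist \<Omega> x"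
  have q: "in_L2 \<Omega> ?q" and le: "L2_norm \<Omega> ?q \<le> H * L2_norm \<Omega> (gradient v)"
    using H test_function_in_H1_0[OF \<Omega> v] test_function_weak_gradient[OF \<Omega> v]
    unfolding hardy_inequality_def by blast+
  have grad: "in_L2 \<Omega> (gradient v)" by (rule test_function_in_L2[OF \<Omega> v])
  have [measurable]: "gradient v \<in> borel_measurable (lebesgue_on \<Omega>)"
      "?q \<in> borel_measurable (lebesgue_on \<Omega>)"
    using grad q by (auto simp: in_L2_def)
  have "(\<integral>\<^sup>+y. ennreal ((norm (gradient v y) + 3 * \<bar>v y\<bar> / boundary_dist \<Omega> y)\<^sup>2) \<partial>lborel)
      = (\<integral>\<^sup>+y. ennreal ((norm (gradient v y) + 3 * \<bar>v y\<bar> / boundary_dist \<Omega> y)\<^sup>2) \<partial>lebesgue_on \<Omega>)"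
    unfolding nn_integral_lebesgue_on[OF \<Omega>]
    by (intro nn_integral_cong)
      (auto simp: indicator_def test_function_eq_0[OF v] gradient_test_function_eq_0[OF v])
  also have "\<dots> \<le> (\<integral>\<^sup>+y. ennreal 2 * ennreal ((norm (gradient v y))\<^sup>2) + ennreal 18 * ennreal ((norm (?q y))\<^sup>2) \<partial>lebesgue_on \<Omega>)"
  proof (rule nn_integral_mono)
    fix y
    have d: "0 \<le> boundary_dist \<Omega> y" by (simp add: boundary_dist_def infdist_nonneg)
    have "norm (gradient v y) + 3 * \<bar>v y\<bar> / boundary_dist \<Omega> y = norm (gradient v y) + 3 * norm (?q y)"
      using d by (simp add: abs_divide)
    moreover have "(norm (gradient v y) + 3 * norm (?q y))\<^sup>2 \<le> 2 * (norm (gradient v y))\<^sup>2 + 18 * (norm (?q y))\<^sup>2"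
      using norm_diff_power2_le[of "norm (gradient v y)" "- 3 * norm (?q y)"]
      by (simp add: power_mult_distrib power_divide)
    ultimately have "ennreal ((norm (gradient v y) + 3 * \<bar>v y\<bar> / boundary_dist \<Omega> y)\<^sup>2)
        \<le> ennreal (2 * (norm (gradient v y))\<^sup>2 + 18 * (norm (?q y))\<^sup>2)"
      by (simp only: ennreal_leI)
    also have "\<dots> = ennreal 2 * ennreal ((norm (gradient v y))\<^sup>2) + ennreal 18 * ennreal ((norm (?q y))\<^sup>2)"
      by (simp only: ennreal_plus ennreal_mult' zero_le_power2 zero_le_numeral mult_nonneg_nonneg)
    finally show "ennreal ((norm (gradient v y) + 3 * \<bar>v y\<bar> / boundary_dist \<Omega> y)\<^sup>2)
        \<le> ennreal 2 * ennreal ((norm (gradient v y))\<^sup>2) + ennreal 18 * ennreal ((norm (?q y))\<^sup>2)" .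
  qed
  also have "\<dots> = (\<integral>\<^sup>+y. ennreal 2 * ennreal ((norm (gradient v y))\<^sup>2) \<partial>lebesgue_on \<Omega>)
      + (\<integral>\<^sup>+y. ennreal 18 * ennreal ((norm (?q y))\<^sup>2) \<partial>lebesgue_on \<Omega>)"
    by (rule nn_integral_add) measurable
  also have "\<dots> = ennreal 2 * ennreal ((L2_norm \<Omega> (gradient v))\<^sup>2) + ennreal 18 * ennreal ((L2_norm \<Omega> ?q)\<^sup>2)"
  proof -
    have "(\<lambda>y. ennreal ((norm (gradient v y))\<^sup>2)) \<in> borel_measurable (lebesgue_on \<Omega>)"
        "(\<lambda>y. ennreal ((norm (?q y))\<^sup>2)) \<in> borel_measurable (lebesgue_on \<Omega>)"
      by measurable
    from nn_integral_cmult[OF this(1)] nn_integral_cmult[OF this(2)] show ?thesis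
      by (simp only: nn_integral_eq_L2_norm_power2[OF grad] nn_integral_eq_L2_norm_power2[OF q])
  qed
  also have "\<dots> = ennreal (2 * (L2_norm \<Omega> (gradient v))\<^sup>2 + 18 * (L2_norm \<Omega> ?q)\<^sup>2)"
    by (simp only: ennreal_plus ennreal_mult' zero_le_power2 zero_le_numeral mult_nonneg_nonneg)
  also have "\<dots> \<le> ennreal ((2 + 18 * H\<^sup>2) * (L2_norm \<Omega> (gradient v))\<^sup>2)"
  proof (rule ennreal_leI)
    have "0 \<le> L2_norm \<Omega> ?q" by (simp add: L2_norm_def)
    then have "(L2_norm \<Omega> ?q)\<^sup>2 \<le> (H * L2_norm \<Omega> (gradient v))\<^sup>2"
      by (intro power_mono le)
    then show "2 * (L2_norm \<Omega> (gradient v))\<^sup>2 + 18 * (L2_norm \<Omega> ?q)\<^sup>2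
        \<le> (2 + 18 * H\<^sup>2) * (L2_norm \<Omega> (gradient v))\<^sup>2"
      by (simp add: power_mult_distrib algebra_simps)
  qed
  finally show ?thesis .
qed

lemma test_function_weighted_exp_integral_le:
  fixes \<Omega> :: "(real ^ 2) set"
  assumes \<Omega>: "open \<Omega>" "frontier \<Omega> \<noteq> {}" and H: "hardy_inequality \<Omega> H" and v: "test_function \<Omega> v"
    and small: "(2 + 18 * H\<^sup>2) * (L2_norm \<Omega> (gradient v))\<^sup>2 \<le> 1 / 12"
  shows "(\<integral>\<^sup>+x. ennreal ((exp (2 * (v x)\<^sup>2) - 1) / (boundary_dist \<Omega> x)\<^sup>2) \<partial>lebesgue_on \<Omega>) \<le> 5"
  unfolding nn_integral_lebesgue_on[OF \<Omega>(1)]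
proof (rule weighted_exp_integral_le)
  show "C_k 1 v" using v by (rule test_function_C_k)
  show "\<Omega> \<in> sets borel" using \<Omega>(1) by (rule borel_open)
  show "v x = 0" "gradient v x = 0" if "x \<notin> \<Omega>" for x
    using test_function_eq_0[OF v that] gradient_test_function_eq_0[OF v that] .
  show "0 < boundary_dist \<Omega> x" if "x \<in> \<Omega>" for x
    using boundary_dist_pos[OF \<Omega> that] .
  show "\<bar>boundary_dist \<Omega> x - boundary_dist \<Omega> y\<bar> \<le> dist x y" for x y
    unfolding boundary_dist_def by (rule infdist_triangle_abs)
  show "boundary_dist \<Omega> \<in> borel_measurable borel"
    by (rule borel_measurable_continuous_onI[OF continuous_on_boundary_dist])
  show "(\<integral>\<^sup>+y. ennreal ((norm (gradient v y) + 3 * \<bar>v y\<bar> / boundary_dist \<Omega> y)\<^sup>2) \<partial>lborel) \<le> ennreal (1 / 12)"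
    by (rule order_trans[OF test_function_hardy_energy_le[OF \<Omega>(1) H v] ennreal_leI[OF small]])
qed

text \<open>An element \<open>u\<close> of the space is a small perturbation of a test function \<open>\<psi>\<close>. The exponential
  integral of \<open>u - \<psi>\<close> is bounded by Fatou's lemma, along an almost everywhere convergent
  subsequence of the approximating test functions.\<close>

lemma H1_0_near_test_function_weighted_exp_integral_le:
  fixes \<Omega> :: "(real ^ 2) set"
  assumes \<Omega>: "open \<Omega>" "frontier \<Omega> \<noteq> {}" and H: "hardy_inequality \<Omega> H" and u: "u \<in> H1_0 \<Omega>"
  obtains \<psi> where "test_function \<Omega> \<psi>"
    "(\<integral>\<^sup>+x. ennreal ((exp (2 * (u x - \<psi> x)\<^sup>2) - 1) / (boundary_dist \<Omega> x)\<^sup>2) \<partial>lebesgue_on \<Omega>) \<le> 5"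
proof -
  from u obtain g \<phi> where u2: "in_L2 \<Omega> u" and g2: "in_L2 \<Omega> g" and \<phi>: "\<And>n. test_function \<Omega> (\<phi> n)"
    and lim_u: "(\<lambda>n. L2_norm \<Omega> (\<lambda>x. \<phi> n x - u x)) \<longlonglongrightarrow> 0"
    and lim_g: "(\<lambda>n. L2_norm \<Omega> (\<lambda>x. gradient (\<phi> n) x - g x)) \<longlonglongrightarrow> 0"
    unfolding H1_0_def by blast
  \<comment> \<open>The factor 4 below is the cost of passing from \<open>\<nabla>\<phi>\<^sub>m - g\<close> and \<open>\<nabla>\<phi>\<^sub>N - g\<close> to \<open>\<nabla>\<phi>\<^sub>m - \<nabla>\<phi>\<^sub>N\<close>.\<close>
  define A where "A = 2 + 18 * H\<^sup>2"
  have A: "0 < A" by (simp add: A_def add_pos_nonneg)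
  have "(\<lambda>n. 4 * A * (L2_norm \<Omega> (\<lambda>x. gradient (\<phi> n) x - g x))\<^sup>2) \<longlonglongrightarrow> 4 * A * 0\<^sup>2"
    by (intro tendsto_intros lim_g)
  then have "\<forall>\<^sub>F n in sequentially. 4 * A * (L2_norm \<Omega> (\<lambda>x. gradient (\<phi> n) x - g x))\<^sup>2 < 1 / 12"
    by (intro order_tendstoD) auto
  then obtain N where N: "\<And>n. N \<le> n \<Longrightarrow> 4 * A * (L2_norm \<Omega> (\<lambda>x. gradient (\<phi> n) x - g x))\<^sup>2 < 1 / 12"
    unfolding eventually_sequentially by blast
  have bound: "(\<integral>\<^sup>+x. ennreal ((exp (2 * (\<phi> m x - \<phi> N x)\<^sup>2) - 1) / (boundary_dist \<Omega> x)\<^sup>2) \<partial>lebesgue_on \<Omega>) \<le> 5"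
    if "N \<le> m" for m
  proof (rule test_function_weighted_exp_integral_le[OF \<Omega> H])
    show "test_function \<Omega> (\<lambda>x. \<phi> m x - \<phi> N x)"
      by (intro test_function_diff \<phi>)
    let ?d = "\<lambda>n. (L2_norm \<Omega> (\<lambda>x. gradient (\<phi> n) x - g x))\<^sup>2"
    have "gradient (\<lambda>x. \<phi> m x - \<phi> N x) = (\<lambda>x. gradient (\<phi> m) x - gradient (\<phi> N) x)"
      by (intro ext gradient_diff test_function_C_k[OF \<phi>])
    then have "(L2_norm \<Omega> (gradient (\<lambda>x. \<phi> m x - \<phi> N x)))\<^sup>2 \<le> 2 * ?d m + 2 * ?d N"
      using L2_norm_diff_power2_le[OF test_function_in_L2(2)[OF \<Omega>(1) \<phi>] test_function_in_L2(2)[OF \<Omega>(1) \<phi>] g2, of m N]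
      by simp
    then have "A * (L2_norm \<Omega> (gradient (\<lambda>x. \<phi> m x - \<phi> N x)))\<^sup>2 \<le> A * (2 * ?d m + 2 * ?d N)"
      using A by (intro mult_left_mono) auto
    also have "\<dots> \<le> 1 / 12"
      using N[OF that] N[OF order_refl] by (simp add: algebra_simps)
    finally show "(2 + 18 * H\<^sup>2) * (L2_norm \<Omega> (gradient (\<lambda>x. \<phi> m x - \<phi> N x)))\<^sup>2 \<le> 1 / 12"
      by (simp only: A_def)
  qed
  have "\<exists>s. strict_mono s \<and> (AE x in lebesgue_on \<Omega>. (\<lambda>n. (norm (\<phi> (s n) x - u x))\<^sup>2) \<longlonglongrightarrow> 0)"
  proof (rule tendsto_L1_AE_subseq)
    show "integrable (lebesgue_on \<Omega>) (\<lambda>x. (norm (\<phi> n x - u x))\<^sup>2)" for n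
      using in_L2_diff[OF test_function_in_L2(1)[OF \<Omega>(1) \<phi>] u2] unfolding in_L2_def by blast
    have "(\<lambda>n. (L2_norm \<Omega> (\<lambda>x. \<phi> n x - u x))\<^sup>2) \<longlonglongrightarrow> 0\<^sup>2"
      by (intro tendsto_power lim_u)
    then show "(\<lambda>n. \<integral>x. norm ((norm (\<phi> n x - u x))\<^sup>2) \<partial>lebesgue_on \<Omega>) \<longlonglongrightarrow> 0"
      unfolding L2_norm_power2 by simp
  qed
  then obtain s :: "nat \<Rightarrow> nat" where s: "strict_mono s"
    and ae: "AE x in lebesgue_on \<Omega>. (\<lambda>n. (norm (\<phi> (s n) x - u x))\<^sup>2) \<longlonglongrightarrow> 0"
    by blast
  define m where "m n = s (n + N)" for n
  have m: "N \<le> m n" for n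
    using strict_mono_imp_increasing[OF s, of "n + N"] by (simp add: m_def)
  have [measurable]: "\<phi> n \<in> borel_measurable (lebesgue_on \<Omega>)" for n
    using test_function_in_L2(1)[OF \<Omega>(1) \<phi>] unfolding in_L2_def by blast
  have [measurable]: "boundary_dist \<Omega> \<in> borel_measurable (lebesgue_on \<Omega>)"
    using borel_measurable_continuous_onI[OF continuous_on_boundary_dist]
    by (intro measurable_restrict_space1 measurable_completion) simp
  define e where "e w x = ennreal ((exp (2 * (w x - \<phi> N x)\<^sup>2) - 1) / (boundary_dist \<Omega> x)\<^sup>2)" for w x
  have "(\<integral>\<^sup>+x. e u x \<partial>lebesgue_on \<Omega>) \<le> (\<integral>\<^sup>+x. liminf (\<lambda>n. e (\<phi> (m n)) x) \<partial>lebesgue_on \<Omega>)"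
  proof (rule nn_integral_mono_AE)
    show "AE x in lebesgue_on \<Omega>. e u x \<le> liminf (\<lambda>n. e (\<phi> (m n)) x)"
      using ae AE_space
    proof eventually_elim
      fix x assume lim: "(\<lambda>n. (norm (\<phi> (s n) x - u x))\<^sup>2) \<longlonglongrightarrow> 0" and "x \<in> space (lebesgue_on \<Omega>)"
      then have "boundary_dist \<Omega> x \<noteq> 0"
        using boundary_dist_pos[OF \<Omega>, of x] by (simp add: space_restrict_space)
      have "(\<lambda>n. sqrt ((norm (\<phi> (s n) x - u x))\<^sup>2)) \<longlonglongrightarrow> sqrt 0"
        by (intro tendsto_real_sqrt lim)
      then have "(\<lambda>n. norm (\<phi> (s n) x - u x)) \<longlonglongrightarrow> 0" by simp
      then have "(\<lambda>n. \<phi> (s n) x) \<longlonglongrightarrow> u x"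
        by (simp only: LIM_zero_cancel tendsto_norm_zero_iff)
      then have "(\<lambda>n. \<phi> (m n) x) \<longlonglongrightarrow> u x"
        unfolding m_def by (rule LIMSEQ_ignore_initial_segment)
      then have "(\<lambda>n. e (\<phi> (m n)) x) \<longlonglongrightarrow> e u x"
        unfolding e_def using \<open>boundary_dist \<Omega> x \<noteq> 0\<close>
        by (intro tendsto_ennrealI tendsto_intros) simp_all
      then have "liminf (\<lambda>n. e (\<phi> (m n)) x) = e u x"
        by (intro lim_imp_Liminf) simp
      then show "e u x \<le> liminf (\<lambda>n. e (\<phi> (m n)) x)" by simp
    qed
  qed
  also have "\<dots> \<le> liminf (\<lambda>n. \<integral>\<^sup>+x. e (\<phi> (m n)) x \<partial>lebesgue_on \<Omega>)"
    by (rule nn_integral_liminf) (unfold e_def, measurable)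
  also have "\<dots> \<le> liminf (\<lambda>n. 5 :: ennreal)"
    by (intro Liminf_mono always_eventually allI) (simp only: e_def bound[OF m])
  also have "\<dots> = 5" by (simp add: Liminf_const)
  finally show thesis
    using that[OF \<phi>[of N]] unfolding e_def by blast
qed

text \<open>Where \<open>\<psi>\<close> vanishes, \<open>u = u - \<psi>\<close>. On the support of \<open>\<psi>\<close>, which is compact in \<open>\<Omega>\<close>, the weight and
  \<open>\<psi>\<close> are bounded, and \<open>u\<^sup>2 \<le> 2 (u - \<psi>)\<^sup>2 + 2 \<psi>\<^sup>2\<close>.\<close>

theorem theorem1:
  fixes \<Omega> :: "(real ^ 2) set" and u :: "real ^ 2 \<Rightarrow> real"
  assumes "open \<Omega>" and "connected \<Omega>" and "frontier \<Omega> \<noteq> {}"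
    and "\<exists>H. hardy_inequality \<Omega> H"
    and "u \<in> H1_0 \<Omega>"
  shows "integrable (lebesgue_on \<Omega>) (\<lambda>x. (exp ((u x)\<^sup>2) - 1) / (boundary_dist \<Omega> x)\<^sup>2)"
proof -
  from assms(4) obtain H where H: "hardy_inequality \<Omega> H" by blast
  from H1_0_near_test_function_weighted_exp_integral_le[OF assms(1,3) H assms(5)]
  obtain \<psi> where \<psi>: "test_function \<Omega> \<psi>"
    and int5: "(\<integral>\<^sup>+x. ennreal ((exp (2 * (u x - \<psi> x)\<^sup>2) - 1) / (boundary_dist \<Omega> x)\<^sup>2) \<partial>lebesgue_on \<Omega>) \<le> 5"
    by blast
  let ?\<delta> = "boundary_dist \<Omega>"
  let ?w = "\<lambda>x. u x - \<psi> x"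
  have [measurable]: "u \<in> borel_measurable (lebesgue_on \<Omega>)" "\<psi> \<in> borel_measurable (lebesgue_on \<Omega>)"
    using assms(5) test_function_in_L2(1)[OF assms(1) \<psi>] by (auto simp: H1_0_def in_L2_def)
  have \<delta>_borel: "?\<delta> \<in> borel_measurable borel"
    by (rule borel_measurable_continuous_onI[OF continuous_on_boundary_dist])
  then have [measurable]: "?\<delta> \<in> borel_measurable (lebesgue_on \<Omega>)"
    by (intro measurable_restrict_space1 measurable_completion) simp
  define K where "K = closure {x. \<psi> x \<noteq> 0}"
  have K: "compact K" "K \<subseteq> \<Omega>" using \<psi> by (auto simp: K_def test_function_def)
  have \<psi>0: "\<psi> x = 0" if "x \<notin> K" for x
    using that closure_subset[of "{x. \<psi> x \<noteq> 0}"] unfolding K_def by blast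
  have "bounded (\<psi> ` K)"
    by (intro compact_imp_bounded compact_continuous_image C_k_1_continuous_on test_function_C_k[OF \<psi>] K)
  then obtain M where "\<And>x. x \<in> K \<Longrightarrow> norm (\<psi> x) \<le> M" by (auto simp: bounded_iff)
  then have M: "(\<psi> x)\<^sup>2 \<le> M\<^sup>2" if "x \<in> K" for x
    using that power_mono[of "\<bar>\<psi> x\<bar>" M 2] by simp
  define C where "C = exp (2 * M\<^sup>2)"
  have C: "1 \<le> C" by (simp add: C_def)
  let ?i = "\<lambda>x. indicator K x *\<^sub>R (1 / (?\<delta> x)\<^sup>2)"
  have "continuous_on K (\<lambda>x. 1 / (?\<delta> x)\<^sup>2)"
  proof (intro continuous_intros continuous_on_boundary_dist ballI)
    fix x assume "x \<in> K"
    with K(2) boundary_dist_pos[OF assms(1,3), of x] show "(?\<delta> x)\<^sup>2 \<noteq> 0" by auto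
  qed
  then have int_i: "integrable lborel ?i"
    by (rule borel_integrable_compact[OF K(1)])
  have [measurable]: "K \<in> sets (lebesgue_on \<Omega>)"
    using K compact_imp_closed[OF K(1)] by (subst sets_restrict_space_iff) (auto simp: assms(1))
  have pointwise: "(exp ((u x)\<^sup>2) - 1) / (?\<delta> x)\<^sup>2
      \<le> C * ((exp (2 * (?w x)\<^sup>2) - 1) / (?\<delta> x)\<^sup>2) + C * ?i x" for x
  proof -
    have "exp ((u x)\<^sup>2) - 1 \<le> C * (exp (2 * (?w x)\<^sup>2) - 1) + C * indicator K x"
    proof (cases "x \<in> K")
      case True
      have "(u x)\<^sup>2 \<le> 2 * (?w x)\<^sup>2 + 2 * (\<psi> x)\<^sup>2"
        using norm_diff_power2_le[of "?w x" "- \<psi> x"] by simp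
      with M[OF True] have "exp ((u x)\<^sup>2) \<le> exp (2 * (?w x)\<^sup>2 + 2 * M\<^sup>2)" by simp
      also have "\<dots> = C * exp (2 * (?w x)\<^sup>2)" by (simp add: C_def exp_add)
      finally show ?thesis using True by (simp add: algebra_simps)
    next
      case False
      have "exp ((u x)\<^sup>2) - 1 \<le> 1 * (exp (2 * (u x)\<^sup>2) - 1)" by simp
      also have "\<dots> \<le> C * (exp (2 * (u x)\<^sup>2) - 1)" by (intro mult_right_mono C) simp
      finally show ?thesis using False by (simp add: \<psi>0)
    qed
    then have "(exp ((u x)\<^sup>2) - 1) / (?\<delta> x)\<^sup>2
        \<le> (C * (exp (2 * (?w x)\<^sup>2) - 1) + C * indicator K x) / (?\<delta> x)\<^sup>2"
      by (rule divide_right_mono) simp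
    then show ?thesis by (simp add: add_divide_distrib)
  qed
  show ?thesis
  proof (rule integrableI_bounded)
    have "(\<integral>\<^sup>+x. ennreal (norm ((exp ((u x)\<^sup>2) - 1) / (?\<delta> x)\<^sup>2)) \<partial>lebesgue_on \<Omega>)
        \<le> (\<integral>\<^sup>+x. ennreal C * ennreal ((exp (2 * (?w x)\<^sup>2) - 1) / (?\<delta> x)\<^sup>2)
          + ennreal C * ennreal (?i x) \<partial>lebesgue_on \<Omega>)"
    proof (rule nn_integral_mono)
      fix x
      have "norm ((exp ((u x)\<^sup>2) - 1) / (?\<delta> x)\<^sup>2) = (exp ((u x)\<^sup>2) - 1) / (?\<delta> x)\<^sup>2" by simp
      also have "ennreal \<dots> \<le> ennreal (C * ((exp (2 * (?w x)\<^sup>2) - 1) / (?\<delta> x)\<^sup>2) + C * ?i x)"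
        by (intro ennreal_leI pointwise)
      also have "\<dots> = ennreal C * ennreal ((exp (2 * (?w x)\<^sup>2) - 1) / (?\<delta> x)\<^sup>2) + ennreal C * ennreal (?i x)"
      proof -
        have "0 \<le> (exp (2 * (?w x)\<^sup>2) - 1) / (?\<delta> x)\<^sup>2" "0 \<le> ?i x" "0 \<le> C"
          using C by simp_all
        then show ?thesis
          by (simp only: ennreal_plus ennreal_mult mult_nonneg_nonneg)
      qed
      finally show "ennreal (norm ((exp ((u x)\<^sup>2) - 1) / (?\<delta> x)\<^sup>2))
          \<le> ennreal C * ennreal ((exp (2 * (?w x)\<^sup>2) - 1) / (?\<delta> x)\<^sup>2) + ennreal C * ennreal (?i x)" .
    qed
    also have "\<dots> = ennreal C * (\<integral>\<^sup>+x. ennreal ((exp (2 * (?w x)\<^sup>2) - 1) / (?\<delta> x)\<^sup>2) \<partial>lebesgue_on \<Omega>)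
        + ennreal C * (\<integral>\<^sup>+x. ennreal (?i x) \<partial>lebesgue_on \<Omega>)"
      by (simp add: nn_integral_add nn_integral_cmult)
    also have "\<dots> < \<infinity>"
    proof -
      have "(\<integral>\<^sup>+x. ennreal (?i x) \<partial>lebesgue_on \<Omega>) \<le> (\<integral>\<^sup>+x. ennreal (norm (?i x)) \<partial>lborel)"
        unfolding nn_integral_lebesgue_on[OF assms(1)]
        by (intro nn_integral_mono) (auto simp: indicator_def)
      also have "\<dots> < \<infinity>" using int_i by (simp add: integrable_iff_bounded)
      finally have "(\<integral>\<^sup>+x. ennreal (?i x) \<partial>lebesgue_on \<Omega>) < \<infinity>" .
      moreover have "(\<integral>\<^sup>+x. ennreal ((exp (2 * (?w x)\<^sup>2) - 1) / (?\<delta> x)\<^sup>2) \<partial>lebesgue_on \<Omega>) < \<infinity>"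
        using int5 by (rule order_le_less_trans) simp
      ultimately show ?thesis by (simp add: ennreal_mult_less_top)
    qed
    finally show "(\<integral>\<^sup>+x. ennreal (norm ((exp ((u x)\<^sup>2) - 1) / (?\<delta> x)\<^sup>2)) \<partial>lebesgue_on \<Omega>) < \<infinity>" .
  qed measurable
qed

end
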